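(* Let $\mathfrak M_i,\mathfrak N_i$ ($1\le i\le k$) be $\mathsf{FO(LFP^1)}$-Henkin structures over $\sigma$, the $\mathfrak M_i$ with pairwise disjoint domains and the $\mathfrak N_i$ with pairwise disjoint domains. For each $i$ let $\bar a_i,\bar b_i$ be non-empty sequences of first-order parameters $a_{i_1},\ldots,a_{i_m}$ in $\mathfrak M_i$ and $b_{i_1},\ldots,b_{i_m}$ in $\mathfrak N_i$, and $\bar A_i,\bar B_i$ sequences of set parameters $A_{i_1},\ldots,A_{i_{m'}}\in\mathbb A_{\mathfrak M_i}$, $B_{i_1},\ldots,B_{i_{m'}}\in\mathbb A_{\mathfrak N_i}$. If $(\mathfrak M_i,\bar A_i,\bar a_i)\equiv^n_{\mathsf{FO(LFP^1)}}(\mathfrak N_i,\bar B_i,\bar b_i)$ for all $1\le i\le k$, then $$\Big(\bigoplus^f_{1\le i\le k}\mathfrak M_i,(\bar A_1,\ldots,\bar A_k)^\cup,\bar a_1,\ldots,\bar a_k\Big)\equiv^n_{\mathsf{FO(LFP^1)}}\Big(\bigoplus^f_{1\le i\le k}\mathfrak N_i,(\bar B_1,\ldots,\bar B_k)^\cup,\bar b_1,\ldots,\bar b_k\Big).$$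
   Context: $\mathsf{FO(LFP^1)}$ extends first-order logic with set variables, atoms $Xy$ and formulas $[LFP_{Xx}\varphi]y$ ($\varphi$ positive in $X$); quantifier depth counts nested first-order quantifiers and $LFP$ operators. Henkin semantics: a frame is a relational structure $\mathfrak M$ with admissible sets $\mathbb A_{\mathfrak M}\subseteq\wp(dom(\mathfrak M))$; set variables take admissible values; $[LFP_{Xx}\varphi]y$ holds under $g$ iff $g(y)\in A$ for every $A\in\mathbb A_{\mathfrak M}$ such that every $a$ with $\mathfrak M,g[a/x,A/X]\models\varphi$ lies in $A$. An $\mathsf{FO(LFP^1)}$-Henkin structure is a frame in which every set $\{a:\mathfrak M,g[a/x]\models\varphi\}$ ($\varphi$ an $\mathsf{FO(LFP^1)}$-formula, $g$ an assignment) is admissible. A parametrized structure $(\mathfrak M,\bar A,\bar a)$ interprets extra unary predicates by $\bar A$ and constants by $\bar a$; $\equiv^n_{\mathsf{FO(LFP^1)}}$ means satisfying the same $\mathsf{FO(LFP^1)}$-formulas of quantifier depth at most $n$ with corresponding parameters. Fusion. $\sigma$ is purely relational, $\sigma^*=\sigma\cup\{Q_1,\ldots,Q_k\}$ with new unary $Q_i$, and $f$ maps each $n$-ary $P\in\sigma$ to a quantifier-free first-order $\sigma^*$-formula in $x_1,\ldots,x_n$. $\biguplus_i\mathfrak M_i$ is the $\sigma^*$-frame with domain $\bigcup_idom(\mathfrak M_i)$, $P\in\sigma$ interpreted as $\bigcup_iP^{\mathfrak M_i}$, $Q_i$ as $dom(\mathfrak M_i)$, admissible sets the sets $\bigcup_iA_i$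 with $A_i\in\mathbb A_{\mathfrak M_i}$. The $f$-fusion $\bigoplus^f_i\mathfrak M_i$ is the $\sigma$-frame with the same domain and admissible sets, each $P\in\sigma$ interpreted as the tuples satisfying $f(P)$ in $\biguplus_i\mathfrak M_i$. For a finite sequence of set parameters $A_1,\ldots,A_k$, $(A_1,\ldots,A_k)^\cup$ is the sequence of all unions $\bigcup_{i\in I}A_i$ for $I\subseteq\{1,\ldots,k\}$, ordered in a fixed canonical way depending on $I$ (the same on both sides). *)

theory Defs
  imports Main "HOL-Library.Disjoint_Sets"
begin

section \<open>Relational vocabularies and \<open>FO(LFP\<^sup>1)\<close> formulas\<close>

text \<open>A purely relational vocabulary is a partial map sending its relation symbols to their
  arities.\<close>

type_synonym 'p voc = "'p \<Rightarrow> nat option"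

text \<open>Formulas are written over a vocabulary expanded by unary predicates (\<open>SPar j\<close>) and constants
  (\<open>Cst j\<close>), which name the entries of the two parameter sequences of a parametrized structure.
  First-order variables and set variables are two separate families, both indexed by \<open>nat\<close>.
  Disjunction, implication and the universal quantifier are the usual shorthands; they have the
  same quantifier depth and polarities as primitive connectives would.\<close>

datatype tm = Var nat | Cst nat

datatype 'p fm =
    Rel 'p "tm list"
  | Eq tm tm
  | SVar nat tm
  | SPar nat tm
  | Neg "'p fm"
  | Conj "'p fm" "'p fm"
  | Ex nat "'p fm"
  | Lfp nat nat "'p fm" tm   \<comment> \<open>\<open>Lfp X x \<phi> t\<close> is \<open>[LFP\<^bsub>Xx\<^esub> \<phi>] t\<close>\<close>

primrec tm_fv :: "tm \<Rightarrow> nat set" where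
  "tm_fv (Var x) = {x}"
| "tm_fv (Cst j) = {}"

primrec fv :: "'p fm \<Rightarrow> nat set" where
  "fv (Rel P ts) = (\<Union>t\<in>set ts. tm_fv t)"
| "fv (Eq s t) = tm_fv s \<union> tm_fv t"
| "fv (SVar X t) = tm_fv t"
| "fv (SPar j t) = tm_fv t"
| "fv (Neg \<phi>) = fv \<phi>"
| "fv (Conj \<phi> \<psi>) = fv \<phi> \<union> fv \<psi>"
| "fv (Ex x \<phi>) = fv \<phi> - {x}"
| "fv (Lfp X x \<phi> t) = (fv \<phi> - {x}) \<union> tm_fv t"

primrec fsv :: "'p fm \<Rightarrow> nat set" where
  "fsv (Rel P ts) = {}"
| "fsv (Eq s t) = {}"
| "fsv (SVar X t) = {X}"
| "fsv (SPar j t) = {}"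
| "fsv (Neg \<phi>) = fsv \<phi>"
| "fsv (Conj \<phi> \<psi>) = fsv \<phi> \<union> fsv \<psi>"
| "fsv (Ex x \<phi>) = fsv \<phi>"
| "fsv (Lfp X x \<phi> t) = fsv \<phi> - {X}"

text \<open>\<open>polar True X \<phi>\<close> (\<open>polar False X \<phi>\<close>): every free occurrence of \<open>X\<close> in \<open>\<phi>\<close> is in the scope
  of an even (odd) number of negations.\<close>

primrec polar :: "bool \<Rightarrow> nat \<Rightarrow> 'p fm \<Rightarrow> bool" where
  "polar b X (Rel P ts) = True"
| "polar b X (Eq s t) = True"
| "polar b X (SVar Y t) = (Y = X \<longrightarrow> b)"
| "polar b X (SPar j t) = True"
| "polar b X (Neg \<phi>) = polar (\<not> b) X \<phi>"
| "polar b X (Conj \<phi> \<psi>) = (polar b X \<phi> \<and> polar b X \<psi>)"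
| "polar b X (Ex x \<phi>) = polar b X \<phi>"
| "polar b X (Lfp Y x \<phi> t) = (Y = X \<or> polar b X \<phi>)"

abbreviation positive_in :: "nat \<Rightarrow> 'p fm \<Rightarrow> bool" where
  "positive_in X \<phi> \<equiv> polar True X \<phi>"

primrec qdepth :: "'p fm \<Rightarrow> nat" where
  "qdepth (Rel P ts) = 0"
| "qdepth (Eq s t) = 0"
| "qdepth (SVar X t) = 0"
| "qdepth (SPar j t) = 0"
| "qdepth (Neg \<phi>) = qdepth \<phi>"
| "qdepth (Conj \<phi> \<psi>) = max (qdepth \<phi>) (qdepth \<psi>)"
| "qdepth (Ex x \<phi>) = Suc (qdepth \<phi>)"
| "qdepth (Lfp X x \<phi> t) = Suc (qdepth \<phi>)"

primrec wf_tm :: "nat \<Rightarrow> tm \<Rightarrow> bool" where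
  "wf_tm c (Var x) = True"
| "wf_tm c (Cst j) = (j < c)"

text \<open>\<open>lfp_formula \<sigma> p c \<phi>\<close>: \<open>\<phi>\<close> is an \<open>FO(LFP\<^sup>1)\<close>-formula over \<open>\<sigma>\<close> expanded by \<open>p\<close> unary
  predicates and \<open>c\<close> constants. The \<open>FO(LFP\<^sup>1)\<close>-formulas over \<open>\<sigma>\<close> itself are those with
  \<open>p = c = 0\<close>.\<close>

primrec lfp_formula :: "'p voc \<Rightarrow> nat \<Rightarrow> nat \<Rightarrow> 'p fm \<Rightarrow> bool" where
  "lfp_formula \<sigma> p c (Rel P ts) = (\<sigma> P = Some (length ts) \<and> (\<forall>t\<in>set ts. wf_tm c t))"
| "lfp_formula \<sigma> p c (Eq s t) = (wf_tm c s \<and> wf_tm c t)"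
| "lfp_formula \<sigma> p c (SVar X t) = wf_tm c t"
| "lfp_formula \<sigma> p c (SPar j t) = (j < p \<and> wf_tm c t)"
| "lfp_formula \<sigma> p c (Neg \<phi>) = lfp_formula \<sigma> p c \<phi>"
| "lfp_formula \<sigma> p c (Conj \<phi> \<psi>) = (lfp_formula \<sigma> p c \<phi> \<and> lfp_formula \<sigma> p c \<psi>)"
| "lfp_formula \<sigma> p c (Ex x \<phi>) = lfp_formula \<sigma> p c \<phi>"
| "lfp_formula \<sigma> p c (Lfp X x \<phi> t) = (lfp_formula \<sigma> p c \<phi> \<and> positive_in X \<phi> \<and> wf_tm c t)"

definition lfp_sentence :: "'p voc \<Rightarrow> nat \<Rightarrow> nat \<Rightarrow> 'p fm \<Rightarrow> bool" where
  "lfp_sentence \<sigma> p c \<phi> \<longleftrightarrow> lfp_formula \<sigma> p c \<phi> \<and> fv \<phi> = {} \<and> fsv \<phi> = {}"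

primrec qf_fo :: "'p fm \<Rightarrow> bool" where
  "qf_fo (Rel P ts) = True"
| "qf_fo (Eq s t) = True"
| "qf_fo (SVar X t) = False"
| "qf_fo (SPar j t) = False"
| "qf_fo (Neg \<phi>) = qf_fo \<phi>"
| "qf_fo (Conj \<phi> \<psi>) = (qf_fo \<phi> \<and> qf_fo \<psi>)"
| "qf_fo (Ex x \<phi>) = False"
| "qf_fo (Lfp X x \<phi> t) = False"


section \<open>Frames and Henkin semantics\<close>

record ('a, 'p) frame =
  carr :: "'a set"
  rel :: "'p \<Rightarrow> 'a list set"
  adm :: "'a set set"

definition is_frame :: "'p voc \<Rightarrow> ('a, 'p) frame \<Rightarrow> bool" where
  "is_frame \<sigma> M \<longleftrightarrow> carr M \<noteq> {} \<and> adm M \<subseteq> Pow (carr M) \<and>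
     (\<forall>P n. \<sigma> P = Some n \<longrightarrow> rel M P \<subseteq> {xs. length xs = n \<and> set xs \<subseteq> carr M})"

primrec val :: "'a list \<Rightarrow> (nat \<Rightarrow> 'a) \<Rightarrow> tm \<Rightarrow> 'a" where
  "val cs g (Var x) = g x"
| "val cs g (Cst j) = cs ! j"

text \<open>\<open>sat M As cs g G \<phi>\<close>: satisfaction in the parametrized structure \<open>(M, As, cs)\<close> under the
  first-order assignment \<open>g\<close> and the set assignment \<open>G\<close>.\<close>

primrec sat :: "('a, 'p) frame \<Rightarrow> 'a set list \<Rightarrow> 'a list \<Rightarrow>
    (nat \<Rightarrow> 'a) \<Rightarrow> (nat \<Rightarrow> 'a set) \<Rightarrow> 'p fm \<Rightarrow> bool" where
  "sat M As cs g G (Rel P ts) = (map (val cs g) ts \<in> rel M P)"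
| "sat M As cs g G (Eq s t) = (val cs g s = val cs g t)"
| "sat M As cs g G (SVar X t) = (val cs g t \<in> G X)"
| "sat M As cs g G (SPar j t) = (val cs g t \<in> As ! j)"
| "sat M As cs g G (Neg \<phi>) = (\<not> sat M As cs g G \<phi>)"
| "sat M As cs g G (Conj \<phi> \<psi>) = (sat M As cs g G \<phi> \<and> sat M As cs g G \<psi>)"
| "sat M As cs g G (Ex x \<phi>) = (\<exists>a\<in>carr M. sat M As cs (g(x := a)) G \<phi>)"
| "sat M As cs g G (Lfp X x \<phi> t) =
     (\<forall>A\<in>adm M. (\<forall>a\<in>carr M. sat M As cs (g(x := a)) (G(X := A)) \<phi> \<longrightarrow> a \<in> A)
        \<longrightarrow> val cs g t \<in> A)"

text \<open>Assignments are constrained only on the variables free in \<open>\<phi>\<close>. Otherwise a frame without any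
  admissible set would have no assignments and be a Henkin structure vacuously.\<close>

definition assignment_for :: "('a, 'p) frame \<Rightarrow> 'p fm \<Rightarrow> (nat \<Rightarrow> 'a) \<Rightarrow> (nat \<Rightarrow> 'a set) \<Rightarrow> bool" where
  "assignment_for M \<phi> g G \<longleftrightarrow> (\<forall>y\<in>fv \<phi>. g y \<in> carr M) \<and> (\<forall>Y\<in>fsv \<phi>. G Y \<in> adm M)"

definition lfp_henkin :: "'p voc \<Rightarrow> ('a, 'p) frame \<Rightarrow> bool" where
  "lfp_henkin \<sigma> M \<longleftrightarrow> is_frame \<sigma> M \<and>
     (\<forall>\<phi> x g G. lfp_formula \<sigma> 0 0 \<phi> \<longrightarrow> assignment_for M \<phi> g G \<longrightarrow>
        {a \<in> carr M. sat M [] [] (g(x := a)) G \<phi>} \<in> adm M)"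

type_synonym ('a, 'p) pstruct = "('a, 'p) frame \<times> 'a set list \<times> 'a list"

text \<open>The assignments \<open>g\<close>, \<open>G\<close> below are immaterial when \<open>\<phi>\<close> is a sentence.\<close>

definition models :: "('a, 'p) pstruct \<Rightarrow> 'p fm \<Rightarrow> bool" where
  "models S \<phi> = (case S of (M, As, cs) \<Rightarrow> \<forall>g G. sat M As cs g G \<phi>)"

definition lfp_equiv :: "'p voc \<Rightarrow> nat \<Rightarrow> ('a, 'p) pstruct \<Rightarrow> ('b, 'p) pstruct \<Rightarrow> bool" where
  "lfp_equiv \<sigma> n S T = (case (S, T) of ((M, As, as), (N, Bs, bs)) \<Rightarrow>
     length As = length Bs \<and> length as = length bs \<and>
     (\<forall>\<phi>. lfp_sentence \<sigma> (length As) (length as) \<phi> \<longrightarrow> qdepth \<phi> \<le> n \<longrightarrow>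
        (models (M, As, as) \<phi> \<longleftrightarrow> models (N, Bs, bs) \<phi>)))"


section \<open>Fusions\<close>

text \<open>In \<open>\<sigma>\<^sup>*\<close>, \<open>Inl P\<close> is the symbol \<open>P\<close> of \<open>\<sigma>\<close> and \<open>Inr i\<close> is \<open>Q\<^sub>i\<close>.\<close>

definition star_voc :: "nat \<Rightarrow> 'p voc \<Rightarrow> ('p + nat) voc" where
  "star_voc k \<sigma> s = (case s of Inl P \<Rightarrow> \<sigma> P | Inr i \<Rightarrow> if i \<in> {1..k} then Some 1 else None)"

definition disjoint_union :: "nat \<Rightarrow> (nat \<Rightarrow> ('a, 'p) frame) \<Rightarrow> ('a, 'p + nat) frame" where
  "disjoint_union k M =
     \<lparr> carr = (\<Union>i\<in>{1..k}. carr (M i)),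
       rel = (\<lambda>s. case s of Inl P \<Rightarrow> (\<Union>i\<in>{1..k}. rel (M i) P)
                          | Inr i \<Rightarrow> {[a] | a. i \<in> {1..k} \<and> a \<in> carr (M i)}),
       adm = {\<Union>i\<in>{1..k}. A i | A. \<forall>i\<in>{1..k}. A i \<in> adm (M i)} \<rparr>"

text \<open>The variables \<open>x\<^sub>1, \<dots>, x\<^sub>n\<close> of \<open>f P\<close> are \<open>0, \<dots>, n - 1\<close>, so that a tuple \<open>xs\<close> is read as
  the assignment \<open>(!) xs\<close>.\<close>

definition fusion_map :: "nat \<Rightarrow> 'p voc \<Rightarrow> ('p \<Rightarrow> ('p + nat) fm) \<Rightarrow> bool" where
  "fusion_map k \<sigma> f \<longleftrightarrow> (\<forall>P n. \<sigma> P = Some n \<longrightarrow>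
     lfp_formula (star_voc k \<sigma>) 0 0 (f P) \<and> qf_fo (f P) \<and> fv (f P) \<subseteq> {..<n})"

definition fusion :: "'p voc \<Rightarrow> ('p \<Rightarrow> ('p + nat) fm) \<Rightarrow> nat \<Rightarrow> (nat \<Rightarrow> ('a, 'p) frame) \<Rightarrow>
    ('a, 'p) frame" where
  "fusion \<sigma> f k M =
     \<lparr> carr = carr (disjoint_union k M),
       rel = (\<lambda>P. {xs. \<sigma> P = Some (length xs) \<and> set xs \<subseteq> carr (disjoint_union k M) \<and>
                       sat (disjoint_union k M) [] [] ((!) xs) (\<lambda>_. {}) (f P)}),
       adm = adm (disjoint_union k M) \<rparr>"

text \<open>All unions of subfamilies of a sequence of sets. The order of \<open>subseqs As\<close> depends only on
  positions in \<open>As\<close>, so the entries of \<open>all_unions As\<close> and \<open>all_unions Bs\<close> at the same place come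
  from the same index set \<open>I\<close> whenever \<open>As\<close> and \<open>Bs\<close> have the same length.\<close>

definition all_unions :: "'a set list \<Rightarrow> 'a set list" where
  "all_unions As = map (\<lambda>Cs. \<Union>(set Cs)) (subseqs As)"

definition join :: "nat \<Rightarrow> (nat \<Rightarrow> 'c list) \<Rightarrow> 'c list" where
  "join k s = concat (map s [1..<Suc k])"

end

theory Submission
  imports Defs
begin

text \<open>A fusion formula is evaluated by an Ehrenfeucht--Fraisse argument carried out componentwise.
  Set variables come with polarities: a position in component \<open>i\<close> is good for \<open>n\<close> more steps
  when every formula of depth at most \<open>n\<close> respecting the polarities is preserved from \<open>M\<^sub>i\<close> to
  \<open>N\<^sub>i\<close>. As finitely many symbols and variable names occur in a given formula, there are only
  finitely many formulas of each depth up to equivalence, which gives the back-and-forth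
  properties. For a fixed point: if \<open>B = \<Union>\<^sub>i B\<^sub>i\<close> refutes \<open>[LFP\<^bsub>Xx\<^esub> \<phi>] t\<close> in the fusion of the
  \<open>N\<^sub>i\<close>, each \<open>B\<^sub>i\<close> is answered by an admissible \<open>A\<^sub>i\<close> such that every point outside \<open>A\<^sub>i\<close> is
  dominated by some point outside \<open>B\<^sub>i\<close>. Then \<open>\<Union>\<^sub>i A\<^sub>i\<close> is closed under \<open>\<phi>\<close>, and it
  omits \<open>t\<close>, whose component is treated with \<open>t\<close> as the refuting point. The other components need
  some named point for this step, which is where the non-empty parameter sequences enter.\<close>

section \<open>Formulas with bounded names and polarities\<close>

text \<open>First-order and set variables share one set of indices, bound names included: a single
  finite bound on all names helps to leave only finitely many formulas of each depth up to
  equivalence.\<close>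

primrec vars :: "'p fm \<Rightarrow> nat set" where
  "vars (Rel P ts) = (\<Union>t\<in>set ts. tm_fv t)"
| "vars (Eq s t) = tm_fv s \<union> tm_fv t"
| "vars (SVar X t) = insert X (tm_fv t)"
| "vars (SPar j t) = tm_fv t"
| "vars (Neg \<phi>) = vars \<phi>"
| "vars (Conj \<phi> \<psi>) = vars \<phi> \<union> vars \<psi>"
| "vars (Ex x \<phi>) = insert x (vars \<phi>)"
| "vars (Lfp X x \<phi> t) = insert X (insert x (vars \<phi> \<union> tm_fv t))"

lemma finite_tm_fv [simp]: "finite (tm_fv t)"
  by (cases t) auto

lemma finite_vars: "finite (vars \<phi>)"
  by (induction \<phi>) auto

lemma finite_set_fm: "finite (set_fm \<phi>)"
  by (induction \<phi>) auto

definition Disj :: "'p fm \<Rightarrow> 'p fm \<Rightarrow> 'p fm" where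
  "Disj \<phi> \<psi> = Neg (Conj (Neg \<phi>) (Neg \<psi>))"

text \<open>A variable with no free occurrence has both polarities, so \<open>Sp\<close> and \<open>Sn\<close> bound the set
  variables occurring positively and negatively. A variable in both is unrestricted.\<close>

definition ctxt_ok :: "nat set \<Rightarrow> nat set \<Rightarrow> nat set \<Rightarrow> 'p fm \<Rightarrow> bool" where
  "ctxt_ok V Sp Sn \<phi> \<longleftrightarrow> fv \<phi> \<subseteq> V \<and> (\<forall>X. X \<notin> Sn \<longrightarrow> polar True X \<phi>) \<and>
     (\<forall>X. X \<notin> Sp \<longrightarrow> polar False X \<phi>)"

lemma ctxt_ok_simps [simp]:
  "ctxt_ok V Sp Sn (Rel P ts) \<longleftrightarrow> (\<Union>t\<in>set ts. tm_fv t) \<subseteq> V"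
  "ctxt_ok V Sp Sn (Eq s t) \<longleftrightarrow> tm_fv s \<subseteq> V \<and> tm_fv t \<subseteq> V"
  "ctxt_ok V Sp Sn (SVar X t) \<longleftrightarrow> X \<in> Sp \<and> tm_fv t \<subseteq> V"
  "ctxt_ok V Sp Sn (SPar j t) \<longleftrightarrow> tm_fv t \<subseteq> V"
  "ctxt_ok V Sp Sn (Neg \<phi>) \<longleftrightarrow> ctxt_ok V Sn Sp \<phi>"
  "ctxt_ok V Sp Sn (Conj \<phi> \<psi>) \<longleftrightarrow> ctxt_ok V Sp Sn \<phi> \<and> ctxt_ok V Sp Sn \<psi>"
  "ctxt_ok V Sp Sn (Disj \<phi> \<psi>) \<longleftrightarrow> ctxt_ok V Sp Sn \<phi> \<and> ctxt_ok V Sp Sn \<psi>"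
  "ctxt_ok V Sp Sn (Ex x \<phi>) \<longleftrightarrow> ctxt_ok (insert x V) Sp Sn \<phi>"
  by (auto simp: ctxt_ok_def Disj_def)

text \<open>The binder cuts \<open>X\<close> off from any polarity it had outside. Within the body,
  positivity is recorded by putting \<open>X\<close> into the positive list and deleting it from the
  negative one.\<close>

lemma ctxt_ok_Lfp:
  "ctxt_ok V Sp Sn (Lfp X x \<phi> t) \<and> positive_in X \<phi> \<longleftrightarrow>
     ctxt_ok (insert x V) (insert X Sp) (Sn - {X}) \<phi> \<and> tm_fv t \<subseteq> V"
  by (auto simp: ctxt_ok_def)

lemma ctxt_ok_mono:
  "ctxt_ok V Sp Sn \<phi> \<Longrightarrow> V \<subseteq> V' \<Longrightarrow> Sp \<subseteq> Sp' \<Longrightarrow> Sn \<subseteq> Sn' \<Longrightarrow> ctxt_ok V' Sp' Sn' \<phi>"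
  unfolding ctxt_ok_def by blast

text \<open>An occurrence cannot lie under both an even and an odd number of negations, so having
  both polarities leaves no free occurrence at all.\<close>

lemma polar_iff_fsv: "polar b X \<phi> \<and> polar (\<not> b) X \<phi> \<longleftrightarrow> X \<notin> fsv \<phi>"
proof (induction \<phi> arbitrary: b)
  case (Neg \<phi>)
  show ?case using Neg[of "\<not> b"] by auto
qed auto

lemma ctxt_ok_sentence: "ctxt_ok {} {} {} \<phi> \<longleftrightarrow> fv \<phi> = {} \<and> fsv \<phi> = {}"
  using polar_iff_fsv[of True _ \<phi>] by (auto simp: ctxt_ok_def)

section \<open>Dependence of truth on the free variables, and adjoining a constant to a set
  variable\<close>

lemma val_cong: "(\<And>x. x \<in> tm_fv t \<Longrightarrow> g x = h x) \<Longrightarrow> val cs g t = val cs h t"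
  by (cases t) auto

lemma sat_cong:
  "(\<And>x. x \<in> fv \<phi> \<Longrightarrow> g x = h x) \<Longrightarrow> (\<And>X. X \<in> fsv \<phi> \<Longrightarrow> G X = H X) \<Longrightarrow>
     sat M As cs g G \<phi> = sat M As cs h H \<phi>"
proof (induction \<phi> arbitrary: g h G H)
  case (Rel P ts)
  have "map (val cs g) ts = map (val cs h) ts"
    using Rel by (auto intro!: val_cong)
  then show ?case by (simp only: sat.simps)
next
  case (Eq s t)
  have "val cs g s = val cs h s" "val cs g t = val cs h t"
    using Eq by (auto intro!: val_cong)
  then show ?case by simp
next
  case (SVar X t)
  have "val cs g t = val cs h t"
    using SVar by (auto intro!: val_cong)
  then show ?case using SVar by simp
next
  case (SPar j t)
  have "val cs g t = val cs h t"
    using SPar by (auto intro!: val_cong)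
  then show ?case by simp
next
  case (Neg \<phi>)
  show ?case using Neg.IH[of g h G H] Neg.prems by auto
next
  case (Conj \<phi> \<psi>)
  show ?case using Conj.IH(1)[of g h G H] Conj.IH(2)[of g h G H] Conj.prems by auto
next
  case (Ex x \<phi>)
  have "sat M As cs (g(x := a)) G \<phi> = sat M As cs (h(x := a)) H \<phi>" for a
    by (rule Ex.IH) (use Ex.prems in auto)
  then show ?case by simp
next
  case (Lfp X x \<phi> t)
  have "sat M As cs (g(x := a)) (G(X := A)) \<phi> = sat M As cs (h(x := a)) (H(X := A)) \<phi>" for a A
    by (rule Lfp.IH) (use Lfp.prems in auto)
  moreover have "val cs g t = val cs h t"
    using Lfp.prems by (auto intro!: val_cong)
  ultimately show ?case by simp
qed

lemma sat_Disj [simp]: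
  "sat M As cs g G (Disj \<phi> \<psi>) \<longleftrightarrow> sat M As cs g G \<phi> \<or> sat M As cs g G \<psi>"
  by (simp add: Disj_def)

text \<open>Substitution of \<open>X \<union> {Cst 0}\<close> for \<open>X\<close>. As \<open>Cst 0\<close> is closed, nothing is captured.\<close>

primrec add_cst :: "nat \<Rightarrow> 'p fm \<Rightarrow> 'p fm" where
  "add_cst X (Rel P ts) = Rel P ts"
| "add_cst X (Eq s t) = Eq s t"
| "add_cst X (SVar Y t) = (if Y = X then Disj (SVar Y t) (Eq t (Cst 0)) else SVar Y t)"
| "add_cst X (SPar j t) = SPar j t"
| "add_cst X (Neg \<phi>) = Neg (add_cst X \<phi>)"
| "add_cst X (Conj \<phi> \<psi>) = Conj (add_cst X \<phi>) (add_cst X \<psi>)"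
| "add_cst X (Ex x \<phi>) = Ex x (add_cst X \<phi>)"
| "add_cst X (Lfp Y x \<phi> t) = Lfp Y x (if Y = X then \<phi> else add_cst X \<phi>) t"

lemma sat_add_cst:
  "sat M As cs g G (add_cst X \<phi>) = sat M As cs g (G(X := insert (cs ! 0) (G X))) \<phi>"
proof (induction \<phi> arbitrary: g G)
  case (Lfp Y x \<phi> t)
  show ?case
  proof (cases "Y = X")
    case False
    then have upd: "(G(Y := A))(X := insert (cs ! 0) ((G(Y := A)) X)) =
        (G(X := insert (cs ! 0) (G X)))(Y := A)" for A
      by (auto simp: fun_eq_iff)
    have "sat M As cs (g(x := a)) (G(Y := A)) (add_cst X \<phi>) =
        sat M As cs (g(x := a)) ((G(X := insert (cs ! 0) (G X)))(Y := A)) \<phi>" for a A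
      by (simp only: Lfp.IH upd)
    with False show ?thesis by (simp del: fun_upd_apply)
  qed (simp del: fun_upd_apply)
qed auto

lemma add_cst_syntax [simp]:
  "qdepth (add_cst X \<phi>) = qdepth \<phi>"
  "vars (add_cst X \<phi>) = vars \<phi>"
  "fv (add_cst X \<phi>) = fv \<phi>"
  "set_fm (add_cst X \<phi>) = set_fm \<phi>"
  by (induction \<phi>) (auto simp: Disj_def)

text \<open>\<open>Disj\<close> puts the old atom under two negations and the new equation has no
  set variable, so parities do not change. Fixed points inside the formula therefore stay
  well-formed under the substitution.\<close>

lemma polar_add_cst [simp]: "polar b Y (add_cst X \<phi>) = polar b Y \<phi>"
  by (induction \<phi> arbitrary: b) (auto simp: Disj_def)

lemma ctxt_ok_add_cst [simp]: "ctxt_ok V Sp Sn (add_cst X \<phi>) = ctxt_ok V Sp Sn \<phi>"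
  by (simp add: ctxt_ok_def)

lemma lfp_formula_add_cst:
  "0 < c \<Longrightarrow> lfp_formula \<sigma> p c \<phi> \<Longrightarrow> lfp_formula \<sigma> p c (add_cst X \<phi>)"
  by (induction \<phi>) (auto simp: Disj_def)


section \<open>Finiteness of the formulas of bounded depth up to equivalence\<close>

definition fragment :: "'p voc \<Rightarrow> 'p set \<Rightarrow> nat set \<Rightarrow> nat \<Rightarrow> nat \<Rightarrow> nat \<Rightarrow> 'p fm set" where
  "fragment \<sigma> \<Sigma> W p c n =
     {\<phi>. lfp_formula \<sigma> p c \<phi> \<and> set_fm \<phi> \<subseteq> \<Sigma> \<and> vars \<phi> \<subseteq> W \<and> qdepth \<phi> \<le> n}"

definition terms :: "nat set \<Rightarrow> nat \<Rightarrow> tm set" where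
  "terms W c = {t. wf_tm c t \<and> tm_fv t \<subseteq> W}"

lemma finite_terms: "finite W \<Longrightarrow> finite (terms W c)"
proof -
  assume "finite W"
  moreover have "terms W c \<subseteq> Var ` W \<union> Cst ` {..<c}"
  proof
    fix t assume "t \<in> terms W c"
    then show "t \<in> Var ` W \<union> Cst ` {..<c}" by (cases t) (auto simp: terms_def)
  qed
  ultimately show ?thesis by (meson finite_UnI finite_imageI finite_lessThan finite_subset)
qed

lemma fragment_simps [simp]:
  "Rel P ts \<in> fragment \<sigma> \<Sigma> W p c n \<longleftrightarrow>
     P \<in> \<Sigma> \<and> \<sigma> P = Some (length ts) \<and> set ts \<subseteq> terms W c"
  "Eq s t \<in> fragment \<sigma> \<Sigma> W p c n \<longleftrightarrow> s \<in> terms W c \<and> t \<in> terms W c"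
  "SVar X t \<in> fragment \<sigma> \<Sigma> W p c n \<longleftrightarrow> X \<in> W \<and> t \<in> terms W c"
  "SPar j t \<in> fragment \<sigma> \<Sigma> W p c n \<longleftrightarrow> j < p \<and> t \<in> terms W c"
  "Neg \<phi> \<in> fragment \<sigma> \<Sigma> W p c n \<longleftrightarrow> \<phi> \<in> fragment \<sigma> \<Sigma> W p c n"
  "Conj \<phi> \<psi> \<in> fragment \<sigma> \<Sigma> W p c n \<longleftrightarrow>
     \<phi> \<in> fragment \<sigma> \<Sigma> W p c n \<and> \<psi> \<in> fragment \<sigma> \<Sigma> W p c n"
  "Disj \<phi> \<psi> \<in> fragment \<sigma> \<Sigma> W p c n \<longleftrightarrow>
     \<phi> \<in> fragment \<sigma> \<Sigma> W p c n \<and> \<psi> \<in> fragment \<sigma> \<Sigma> W p c n"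
  "Ex x \<phi> \<in> fragment \<sigma> \<Sigma> W p c (Suc n) \<longleftrightarrow> x \<in> W \<and> \<phi> \<in> fragment \<sigma> \<Sigma> W p c n"
  "Lfp X x \<phi> t \<in> fragment \<sigma> \<Sigma> W p c (Suc n) \<longleftrightarrow>
     X \<in> W \<and> x \<in> W \<and> \<phi> \<in> fragment \<sigma> \<Sigma> W p c n \<and> positive_in X \<phi> \<and> t \<in> terms W c"
  "Ex x \<phi> \<notin> fragment \<sigma> \<Sigma> W p c 0"
  "Lfp X x \<phi> t \<notin> fragment \<sigma> \<Sigma> W p c 0"
  by (auto simp: fragment_def terms_def Disj_def)

lemma terms_simps [simp]: "Var x \<in> terms W c \<longleftrightarrow> x \<in> W" "Cst j \<in> terms W c \<longleftrightarrow> j < c"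
  by (auto simp: terms_def)

lemma fragment_mono: "\<phi> \<in> fragment \<sigma> \<Sigma> W p c m \<Longrightarrow> m \<le> n \<Longrightarrow> \<phi> \<in> fragment \<sigma> \<Sigma> W p c n"
  by (auto simp: fragment_def)

lemma add_cst_in_fragment:
  "0 < c \<Longrightarrow> \<phi> \<in> fragment \<sigma> \<Sigma> W p c n \<Longrightarrow> add_cst X \<phi> \<in> fragment \<sigma> \<Sigma> W p c n"
  by (auto simp: fragment_def lfp_formula_add_cst)

text \<open>Only a finite superset of the atomic formulas of a fragment is wanted: for
  \<open>P\<close> outside the vocabulary, \<open>the (\<sigma> P)\<close> is an unspecified length,
  and the extra atoms do no harm.\<close>

definition atomics :: "'p voc \<Rightarrow> 'p set \<Rightarrow> nat set \<Rightarrow> nat \<Rightarrow> nat \<Rightarrow> 'p fm set" where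
  "atomics \<sigma> \<Sigma> W p c =
     (\<Union>P\<in>\<Sigma>. Rel P ` {ts. set ts \<subseteq> terms W c \<and> length ts = the (\<sigma> P)}) \<union>
     case_prod Eq ` (terms W c \<times> terms W c) \<union>
     case_prod SVar ` (W \<times> terms W c) \<union>
     case_prod SPar ` ({..<p} \<times> terms W c)"

lemma finite_atomics: "finite \<Sigma> \<Longrightarrow> finite W \<Longrightarrow> finite (atomics \<sigma> \<Sigma> W p c)"
  unfolding atomics_def using finite_terms[of W c] finite_lists_length_eq[of "terms W c"] by auto

text \<open>Equality of truth sets is equivalence relative to one parametrized structure, over all
  assignments, admissible or not.\<close>

definition truth_set :: "('a, 'p) frame \<Rightarrow> 'a set list \<Rightarrow> 'a list \<Rightarrow> 'p fm \<Rightarrow>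
    ((nat \<Rightarrow> 'a) \<times> (nat \<Rightarrow> 'a set)) set" where
  "truth_set M As cs \<phi> = {(g, G). sat M As cs g G \<phi>}"

text \<open>Finitely many sets have only finitely many Boolean combinations. The generators are the
  formulas of the fragment that are neither negations nor conjunctions, and \<open>K\<close> has to
  contain them.\<close>

lemma finite_truth_sets_closure:
  assumes fin: "finite (truth_set M As cs ` K)"
    and atom: "\<And>\<phi>. \<phi> \<in> fragment \<sigma> \<Sigma> W p c n \<Longrightarrow>
      (\<And>\<psi>. \<phi> \<noteq> Neg \<psi>) \<Longrightarrow> (\<And>\<psi> \<chi>. \<phi> \<noteq> Conj \<psi> \<chi>) \<Longrightarrow> \<phi> \<in> K"
  shows "finite (truth_set M As cs ` fragment \<sigma> \<Sigma> W p c n)"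
proof -
  define \<K> where "\<K> = truth_set M As cs ` K"
  \<comment> \<open>The profile of a pair of assignments is the set of generating truth sets it lies
    in; every truth set is a union of profile classes.\<close>
  define prof where "prof w = {T \<in> \<K>. w \<in> T}" for w
  have combination: "\<exists>\<S>\<subseteq>Pow \<K>. truth_set M As cs \<phi> = {w. prof w \<in> \<S>}"
    if "\<phi> \<in> fragment \<sigma> \<Sigma> W p c n" for \<phi>
  proof -
    have base: "\<exists>\<S>\<subseteq>Pow \<K>. truth_set M As cs \<psi> = {w. prof w \<in> \<S>}" if "\<psi> \<in> K" for \<psi>
      by (rule exI[of _ "{S \<in> Pow \<K>. truth_set M As cs \<psi> \<in> S}"])
        (use that in \<open>auto simp: \<K>_def prof_def\<close>)
    have neg: "\<exists>\<S>\<subseteq>Pow \<K>. truth_set M As cs (Neg \<phi>) = {w. prof w \<in> \<S>}"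
      if "\<exists>\<S>\<subseteq>Pow \<K>. truth_set M As cs \<phi> = {w. prof w \<in> \<S>}" for \<phi>
    proof -
      from that obtain \<S> where "truth_set M As cs \<phi> = {w. prof w \<in> \<S>}" by blast
      moreover have "truth_set M As cs (Neg \<phi>) = - truth_set M As cs \<phi>"
        by (auto simp: truth_set_def)
      ultimately have "truth_set M As cs (Neg \<phi>) = {w. prof w \<in> Pow \<K> - \<S>}"
        by (auto simp: prof_def)
      then show ?thesis by (intro exI[of _ "Pow \<K> - \<S>"]) simp
    qed
    have conj: "\<exists>\<S>\<subseteq>Pow \<K>. truth_set M As cs (Conj \<phi> \<psi>) = {w. prof w \<in> \<S>}"
      if "\<exists>\<S>\<subseteq>Pow \<K>. truth_set M As cs \<phi> = {w. prof w \<in> \<S>}"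
        "\<exists>\<S>\<subseteq>Pow \<K>. truth_set M As cs \<psi> = {w. prof w \<in> \<S>}" for \<phi> \<psi>
    proof -
      from that obtain \<S> \<T> where ST: "\<S> \<subseteq> Pow \<K>" "truth_set M As cs \<phi> = {w. prof w \<in> \<S>}"
        "truth_set M As cs \<psi> = {w. prof w \<in> \<T>}" by blast
      have "truth_set M As cs (Conj \<phi> \<psi>) = truth_set M As cs \<phi> \<inter> truth_set M As cs \<psi>"
        by (auto simp: truth_set_def)
      with ST have "truth_set M As cs (Conj \<phi> \<psi>) = {w. prof w \<in> \<S> \<inter> \<T>}"
        by auto
      with ST(1) show ?thesis by (intro exI[of _ "\<S> \<inter> \<T>"]) auto
    qed
    show ?thesis
      using that
    proof (induction \<phi>)
      case (Neg \<phi>)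
      then show ?case by (intro neg) simp
    next
      case (Conj \<phi> \<psi>)
      then show ?case by (intro conj) simp_all
    \<comment> \<open>The six remaining constructors are generators, so \<open>atom\<close> puts
      them into \<open>K\<close>.\<close>
    qed (rule base, rule atom, assumption, simp, simp)+
  qed
  have "truth_set M As cs ` fragment \<sigma> \<Sigma> W p c n \<subseteq> (\<lambda>\<S>. {w. prof w \<in> \<S>}) ` Pow (Pow \<K>)"
  proof (rule image_subsetI)
    fix \<phi> assume "\<phi> \<in> fragment \<sigma> \<Sigma> W p c n"
    from combination[OF this] obtain \<S> where
      "\<S> \<subseteq> Pow \<K>" "truth_set M As cs \<phi> = {w. prof w \<in> \<S>}" by blast
    then show "truth_set M As cs \<phi> \<in> (\<lambda>\<S>. {w. prof w \<in> \<S>}) ` Pow (Pow \<K>)"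
      by (simp add: image_eqI)
  qed
  moreover have "finite \<K>" using fin by (simp add: \<K>_def)
  ultimately show ?thesis by (meson finite_Pow_iff finite_imageI finite_subset)
qed

text \<open>The truth set of \<open>Ex x \<phi>\<close> or \<open>Lfp X x \<phi> t\<close> depends
  on \<open>\<phi>\<close> only through its truth set, so finitely many truth sets at depth
  \<open>n\<close> give finitely many generators at depth \<open>Suc n\<close>.\<close>

lemma finite_truth_sets:
  assumes "finite \<Sigma>" "finite W"
  shows "finite (truth_set M As cs ` fragment \<sigma> \<Sigma> W p c n)"
proof (induction n)
  case 0
  show ?case
  proof (rule finite_truth_sets_closure)
    show "finite (truth_set M As cs ` atomics \<sigma> \<Sigma> W p c)"
      using finite_atomics[OF assms] by blast
    fix \<phi> assume "\<phi> \<in> fragment \<sigma> \<Sigma> W p c 0" "\<And>\<psi>. \<phi> \<noteq> Neg \<psi>" "\<And>\<psi> \<chi>. \<phi> \<noteq> Conj \<psi> \<chi>"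
    then show "\<phi> \<in> atomics \<sigma> \<Sigma> W p c"
      by (cases \<phi>) (auto simp: atomics_def image_iff)
  qed
next
  case (Suc n)
  let ?F = "fragment \<sigma> \<Sigma> W p c n"
  let ?E = "case_prod Ex ` (W \<times> ?F)"
  let ?L = "(\<lambda>(X, x, \<phi>, t). Lfp X x \<phi> t) ` (W \<times> W \<times> ?F \<times> terms W c)"
  show ?case
  proof (rule finite_truth_sets_closure)
    have "truth_set M As cs ` ?E \<subseteq>
        (\<lambda>(x, T). {(g, G). \<exists>a\<in>carr M. (g(x := a), G) \<in> T}) ` (W \<times> truth_set M As cs ` ?F)"
      by (force simp: truth_set_def image_iff)
    then have E: "finite (truth_set M As cs ` ?E)"
      by (rule finite_subset) (use Suc assms in auto)
    have "truth_set M As cs ` ?L \<subseteq>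
        (\<lambda>(X, x, T, t). {(g, G). \<forall>A\<in>adm M.
            (\<forall>a\<in>carr M. (g(x := a), G(X := A)) \<in> T \<longrightarrow> a \<in> A) \<longrightarrow> val cs g t \<in> A}) `
          (W \<times> W \<times> truth_set M As cs ` ?F \<times> terms W c)"
    proof clarify
      fix X x \<phi> t
      assume "X \<in> W" "x \<in> W" "\<phi> \<in> ?F" "t \<in> terms W c"
      then show "truth_set M As cs (Lfp X x \<phi> t) \<in>
        (\<lambda>(X, x, T, t). {(g, G). \<forall>A\<in>adm M.
            (\<forall>a\<in>carr M. (g(x := a), G(X := A)) \<in> T \<longrightarrow> a \<in> A) \<longrightarrow> val cs g t \<in> A}) `
          (W \<times> W \<times> truth_set M As cs ` ?F \<times> terms W c)"
        by (intro image_eqI[of _ _ "(X, x, truth_set M As cs \<phi>, t)"]) (auto simp: truth_set_def)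
    qed
    then have L: "finite (truth_set M As cs ` ?L)"
      by (rule finite_subset) (use Suc assms finite_terms in auto)
    show "finite (truth_set M As cs ` (atomics \<sigma> \<Sigma> W p c \<union> ?E \<union> ?L))"
      unfolding image_Un using E L finite_atomics[OF assms] by blast
    fix \<phi> assume "\<phi> \<in> fragment \<sigma> \<Sigma> W p c (Suc n)" "\<And>\<psi>. \<phi> \<noteq> Neg \<psi>" "\<And>\<psi> \<chi>. \<phi> \<noteq> Conj \<psi> \<chi>"
    then show "\<phi> \<in> atomics \<sigma> \<Sigma> W p c \<union> ?E \<union> ?L"
      by (cases \<phi>) (auto simp: atomics_def image_iff)
  qed
qed


section \<open>Back-and-forth properties\<close>

text \<open>The last conjunct makes the empty conjunction true without a variable, which the context
  might forbid. It mentions a constant, whence the condition \<open>0 < c\<close> below.\<close>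

definition big_conj :: "'p fm set \<Rightarrow> 'p fm" where
  "big_conj F = foldr Conj (SOME \<phi>s. set \<phi>s = F) (Eq (Cst 0) (Cst 0))"

definition big_disj :: "'p fm set \<Rightarrow> 'p fm" where
  "big_disj F = Neg (big_conj (Neg ` F))"

lemma foldr_Conj:
  "sat M As cs g G (foldr Conj \<phi>s \<theta>) \<longleftrightarrow> (\<forall>\<phi>\<in>set \<phi>s. sat M As cs g G \<phi>) \<and> sat M As cs g G \<theta>"
  "foldr Conj \<phi>s \<theta> \<in> fragment \<sigma> \<Sigma> W p c n \<longleftrightarrow>
     set \<phi>s \<subseteq> fragment \<sigma> \<Sigma> W p c n \<and> \<theta> \<in> fragment \<sigma> \<Sigma> W p c n"
  "ctxt_ok V Sp Sn (foldr Conj \<phi>s \<theta>) \<longleftrightarrow> (\<forall>\<phi>\<in>set \<phi>s. ctxt_ok V Sp Sn \<phi>) \<and> ctxt_ok V Sp Sn \<theta>"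
  by (induction \<phi>s) auto

lemma big_conj:
  assumes "finite F"
  shows "sat M As cs g G (big_conj F) \<longleftrightarrow> (\<forall>\<phi>\<in>F. sat M As cs g G \<phi>)"
    and "0 < c \<Longrightarrow> big_conj F \<in> fragment \<sigma> \<Sigma> W p c n \<longleftrightarrow> F \<subseteq> fragment \<sigma> \<Sigma> W p c n"
    and "ctxt_ok V Sp Sn (big_conj F) \<longleftrightarrow> (\<forall>\<phi>\<in>F. ctxt_ok V Sp Sn \<phi>)"
proof -
  have "set (SOME \<phi>s. set \<phi>s = F) = F"
    using someI_ex[OF finite_list[OF assms]] .
  then show "sat M As cs g G (big_conj F) \<longleftrightarrow> (\<forall>\<phi>\<in>F. sat M As cs g G \<phi>)"
    and "0 < c \<Longrightarrow> big_conj F \<in> fragment \<sigma> \<Sigma> W p c n \<longleftrightarrow> F \<subseteq> fragment \<sigma> \<Sigma> W p c n"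
    and "ctxt_ok V Sp Sn (big_conj F) \<longleftrightarrow> (\<forall>\<phi>\<in>F. ctxt_ok V Sp Sn \<phi>)"
    by (simp_all add: big_conj_def foldr_Conj)
qed

lemma big_disj:
  assumes "finite F"
  shows "sat M As cs g G (big_disj F) \<longleftrightarrow> (\<exists>\<phi>\<in>F. sat M As cs g G \<phi>)"
    and "0 < c \<Longrightarrow> big_disj F \<in> fragment \<sigma> \<Sigma> W p c n \<longleftrightarrow> F \<subseteq> fragment \<sigma> \<Sigma> W p c n"
    and "ctxt_ok V Sp Sn (big_disj F) \<longleftrightarrow> (\<forall>\<phi>\<in>F. ctxt_ok V Sp Sn \<phi>)"
proof -
  have fin: "finite (Neg ` F)" using assms by blast
  show "sat M As cs g G (big_disj F) \<longleftrightarrow> (\<exists>\<phi>\<in>F. sat M As cs g G \<phi>)"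
    and "0 < c \<Longrightarrow> big_disj F \<in> fragment \<sigma> \<Sigma> W p c n \<longleftrightarrow> F \<subseteq> fragment \<sigma> \<Sigma> W p c n"
    and "ctxt_ok V Sp Sn (big_disj F) \<longleftrightarrow> (\<forall>\<phi>\<in>F. ctxt_ok V Sp Sn \<phi>)"
    by (auto simp: big_disj_def big_conj[OF fin])
qed

text \<open>Both sets are definable from \<open>A\<close>, as the value of a set variable, and
  \<open>c\<close>, as the value of variable \<open>1\<close>; the Henkin condition makes them
  admissible.\<close>

lemma lfp_henkin_insert_remove:
  fixes M :: "('a, 'p) frame"
  assumes "lfp_henkin \<sigma> M" "A \<in> adm M" "c \<in> carr M"
  shows "insert c A \<in> adm M" "A - {c} \<in> adm M"
proof -
  have A: "A \<subseteq> carr M" using assms by (auto simp: lfp_henkin_def is_frame_def)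
  define g where "g = (\<lambda>_::nat. c)"
  define G where "G = (\<lambda>_::nat. A)"
  define \<phi> :: "'p fm" where "\<phi> = Disj (SVar 0 (Var 0)) (Eq (Var 0) (Var 1))"
  define \<psi> :: "'p fm" where "\<psi> = Conj (SVar 0 (Var 0)) (Neg (Eq (Var 0) (Var 1)))"
  have def: "{a \<in> carr M. sat M [] [] (g(0 := a)) G \<theta>} \<in> adm M" if "\<theta> \<in> {\<phi>, \<psi>}" for \<theta>
  proof -
    have "lfp_formula \<sigma> 0 0 \<theta>" "assignment_for M \<theta> g G"
      using that assms(2,3)
      by (auto simp: \<phi>_def \<psi>_def Disj_def assignment_for_def g_def G_def)
    with assms(1) show ?thesis by (auto simp: lfp_henkin_def)
  qed
  have "insert c A = {a \<in> carr M. sat M [] [] (g(0 := a)) G \<phi>}"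
    using A assms(3) by (auto simp: \<phi>_def g_def G_def)
  then show "insert c A \<in> adm M" using def[of \<phi>] by simp
  have "A - {c} = {a \<in> carr M. sat M [] [] (g(0 := a)) G \<psi>}"
    using A assms(3) by (auto simp: \<psi>_def g_def G_def)
  then show "A - {c} \<in> adm M" using def[of \<psi>] by simp
qed

lemma sat_upd_irrelevant:
  "x \<notin> fv \<phi> \<Longrightarrow> sat M As cs (g(x := a)) G \<phi> = sat M As cs g G \<phi>"
  by (rule sat_cong) auto

text \<open>To be instantiated for one formula of the fusion at a time: \<open>W\<close> holds its
  variable names, \<open>\<Sigma>\<close> the symbols that the components need for evaluating
  it.\<close>

locale finite_language =
  fixes \<sigma> :: "'p voc" and \<Sigma> :: "'p set" and W :: "nat set"
  assumes finite_\<Sigma>: "finite \<Sigma>" and finite_W: "finite W"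
begin

text \<open>One direction only, because in the fixed point step the sets chosen for \<open>X\<close>
  match in positive occurrences alone. If \<open>Sp = Sn\<close>, closure under negation turns
  preservation into equivalence.\<close>

definition preserves :: "nat \<Rightarrow> nat set \<Rightarrow> nat set \<Rightarrow> nat set \<Rightarrow>
    ('a, 'p) frame \<Rightarrow> 'a set list \<Rightarrow> 'a list \<Rightarrow> (nat \<Rightarrow> 'a) \<Rightarrow> (nat \<Rightarrow> 'a set) \<Rightarrow>
    ('b, 'p) frame \<Rightarrow> 'b set list \<Rightarrow> 'b list \<Rightarrow> (nat \<Rightarrow> 'b) \<Rightarrow> (nat \<Rightarrow> 'b set) \<Rightarrow> bool" where
  "preserves n V Sp Sn M As cs g G N Bs ds h H \<longleftrightarrow>
     length As = length Bs \<and> length cs = length ds \<and>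
     (\<forall>\<phi>\<in>fragment \<sigma> \<Sigma> W (length As) (length cs) n. ctxt_ok V Sp Sn \<phi> \<longrightarrow>
        sat M As cs g G \<phi> \<longrightarrow> sat N Bs ds h H \<phi>)"

lemma preservesD:
  assumes "preserves n V Sp Sn M As cs g G N Bs ds h H"
    "\<phi> \<in> fragment \<sigma> \<Sigma> W (length As) (length cs) n" "ctxt_ok V Sp Sn \<phi>"
    "sat M As cs g G \<phi>"
  shows "sat N Bs ds h H \<phi>"
  using assms by (auto simp: preserves_def)

text \<open>Contraposition: negating a formula exchanges the two polarity lists.\<close>

lemma preserves_swap:
  assumes "preserves n V Sp Sn M As cs g G N Bs ds h H"
  shows "preserves n V Sn Sp N Bs ds h H M As cs g G"
  unfolding preserves_def
proof (intro conjI ballI impI)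
  show "length Bs = length As" "length ds = length cs"
    using assms by (simp_all add: preserves_def)
  fix \<phi>
  assume "\<phi> \<in> fragment \<sigma> \<Sigma> W (length Bs) (length ds) n" "ctxt_ok V Sn Sp \<phi>" "sat N Bs ds h H \<phi>"
  then show "sat M As cs g G \<phi>"
    using assms preservesD[OF assms, of "Neg \<phi>"] by (auto simp: preserves_def)
qed

lemma preserves_mono:
  assumes "preserves n V Sp Sn M As cs g G N Bs ds h H"
    and "m \<le> n" "V' \<subseteq> V" "Sp' \<subseteq> Sp" "Sn' \<subseteq> Sn"
  shows "preserves m V' Sp' Sn' M As cs g G N Bs ds h H"
  using assms(1) fragment_mono[OF _ assms(2)] ctxt_ok_mono[OF _ assms(3-5)]
  unfolding preserves_def by blast

lemma ctxt_ok_notin_fsv: "ctxt_ok V Sp Sn \<phi> \<Longrightarrow> X \<in> fsv \<phi> \<Longrightarrow> X \<in> Sp \<union> Sn"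
  using polar_iff_fsv[of True X \<phi>] by (auto simp: ctxt_ok_def)

lemma preserves_cong:
  assumes "preserves n V Sp Sn M As cs g G N Bs ds h H"
    and "\<And>x. x \<in> V \<Longrightarrow> g' x = g x" "\<And>x. x \<in> V \<Longrightarrow> h' x = h x"
    and "\<And>X. X \<in> Sp \<union> Sn \<Longrightarrow> G' X = G X" "\<And>X. X \<in> Sp \<union> Sn \<Longrightarrow> H' X = H X"
  shows "preserves n V Sp Sn M As cs g' G' N Bs ds h' H'"
  unfolding preserves_def
proof (intro conjI ballI impI)
  show "length As = length Bs" "length cs = length ds"
    using assms by (simp_all add: preserves_def)
  fix \<phi>
  assume \<phi>: "\<phi> \<in> fragment \<sigma> \<Sigma> W (length As) (length cs) n" "ctxt_ok V Sp Sn \<phi>"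
    and sat: "sat M As cs g' G' \<phi>"
  have V: "x \<in> V" if "x \<in> fv \<phi>" for x using that \<phi>(2) by (auto simp: ctxt_ok_def)
  have S: "X \<in> Sp \<union> Sn" if "X \<in> fsv \<phi>" for X
    using that \<phi>(2) by (rule ctxt_ok_notin_fsv[rotated])
  have "sat M As cs g' G' \<phi> = sat M As cs g G \<phi>"
    by (rule sat_cong) (use V S assms(2,4) in auto)
  moreover have "sat N Bs ds h' H' \<phi> = sat N Bs ds h H \<phi>"
    by (rule sat_cong) (use V S assms(3,5) in auto)
  ultimately show "sat N Bs ds h' H' \<phi>"
    using preservesD[OF assms(1) \<phi>] sat by simp
qed

section \<open>Finite types and the back-and-forth steps of a single component\<close>

lemma representatives:
  obtains F where "finite F" "F \<subseteq> fragment \<sigma> \<Sigma> W p c n" "\<And>\<phi>. \<phi> \<in> F \<Longrightarrow> ctxt_ok V Sp Sn \<phi>"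
    "\<And>\<phi>. \<phi> \<in> fragment \<sigma> \<Sigma> W p c n \<Longrightarrow> ctxt_ok V Sp Sn \<phi> \<Longrightarrow> \<exists>\<psi>\<in>F.
       (\<forall>g G. sat M As cs g G \<psi> = sat M As cs g G \<phi>) \<and>
       (\<forall>h H. sat N Bs ds h H \<psi> = sat N Bs ds h H \<phi>)"
proof -
  \<comment> \<open>Pairing the truth sets makes one representative valid in both
    structures.\<close>
  let ?t = "\<lambda>\<phi>. (truth_set M As cs \<phi>, truth_set N Bs ds \<phi>)"
  let ?L = "{\<phi> \<in> fragment \<sigma> \<Sigma> W p c n. ctxt_ok V Sp Sn \<phi>}"
  have "?t ` ?L \<subseteq> truth_set M As cs ` fragment \<sigma> \<Sigma> W p c n \<times>
      truth_set N Bs ds ` fragment \<sigma> \<Sigma> W p c n" by auto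
  then have "finite (?t ` ?L)"
    by (rule finite_subset)
      (simp add: finite_truth_sets finite_\<Sigma> finite_W)
  then obtain F where F: "F \<subseteq> ?L" "finite F" "?t ` ?L = ?t ` F"
    using finite_subset_image[of "?t ` ?L" ?t ?L] by blast
  have "\<exists>\<psi>\<in>F. (\<forall>g G. sat M As cs g G \<psi> = sat M As cs g G \<phi>) \<and>
       (\<forall>h H. sat N Bs ds h H \<psi> = sat N Bs ds h H \<phi>)" if "\<phi> \<in> ?L" for \<phi>
  proof -
    from that F(3) obtain \<psi> where "\<psi> \<in> F" "?t \<phi> = ?t \<psi>" by blast
    then show ?thesis
      by (intro bexI[of _ \<psi>]) (auto simp: truth_set_def set_eq_iff)
  qed
  with F(1,2) show ?thesis by (intro that[of F]) auto
qed

lemma preserves_representatives: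
  assumes "length As = length Bs" "length cs = length ds"
    and F: "\<And>\<phi>. \<phi> \<in> fragment \<sigma> \<Sigma> W (length As) (length cs) n \<Longrightarrow> ctxt_ok V Sp Sn \<phi> \<Longrightarrow> \<exists>\<psi>\<in>F.
       (\<forall>g G. sat M As cs g G \<psi> = sat M As cs g G \<phi>) \<and>
       (\<forall>h H. sat N Bs ds h H \<psi> = sat N Bs ds h H \<phi>)"
    and "\<And>\<psi>. \<psi> \<in> F \<Longrightarrow> sat M As cs g G \<psi> \<Longrightarrow> sat N Bs ds h H \<psi>"
  shows "preserves n V Sp Sn M As cs g G N Bs ds h H"
  using assms(1,2) assms(4) F unfolding preserves_def by blast

text \<open>The conjunction \<open>big_conj D\<close> of the representatives true at
  \<open>a\<close> is the type of \<open>a\<close>. Its existential quantification has depth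
  \<open>Suc n\<close>, so it transfers, and a witness in \<open>N\<close> answers
  \<open>a\<close>.\<close>

lemma preserves_Ex:
  assumes pres: "preserves (Suc n) V Sp Sn M As cs g G N Bs ds h H"
    and "x \<in> W" "a \<in> carr M" "cs \<noteq> []"
  obtains b where "b \<in> carr N"
    "preserves n (insert x V) Sp Sn M As cs (g(x := a)) G N Bs ds (h(x := b)) H"
proof -
  let ?L = "fragment \<sigma> \<Sigma> W (length As) (length cs) n"
  have len: "length As = length Bs" "length cs = length ds" "0 < length cs"
    using pres \<open>cs \<noteq> []\<close> by (auto simp: preserves_def)
  obtain F where F: "finite F" "F \<subseteq> ?L" "\<And>\<phi>. \<phi> \<in> F \<Longrightarrow> ctxt_ok (insert x V) Sp Sn \<phi>"
    "\<And>\<phi>. \<phi> \<in> ?L \<Longrightarrow> ctxt_ok (insert x V) Sp Sn \<phi> \<Longrightarrow> \<exists>\<psi>\<in>F.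
       (\<forall>g G. sat M As cs g G \<psi> = sat M As cs g G \<phi>) \<and>
       (\<forall>h H. sat N Bs ds h H \<psi> = sat N Bs ds h H \<phi>)"
    using representatives[of "length As" "length cs" n "insert x V" Sp Sn M As cs N Bs ds]
    by metis
  define D where "D = {\<psi> \<in> F. sat M As cs (g(x := a)) G \<psi>}"
  have D: "finite D" "D \<subseteq> F" using F(1) by (auto simp: D_def)
  have "sat N Bs ds h H (Ex x (big_conj D))"
  proof (rule preservesD[OF pres])
    show "Ex x (big_conj D) \<in> fragment \<sigma> \<Sigma> W (length As) (length cs) (Suc n)"
      using D F(2) len \<open>x \<in> W\<close> by (simp add: big_conj)
    show "ctxt_ok V Sp Sn (Ex x (big_conj D))"
      using D F(3) by (auto simp: big_conj)
    show "sat M As cs g G (Ex x (big_conj D))"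
      using D \<open>a \<in> carr M\<close> by (auto simp: big_conj D_def)
  qed
  then obtain b where b: "b \<in> carr N" "\<And>\<psi>. \<psi> \<in> D \<Longrightarrow> sat N Bs ds (h(x := b)) H \<psi>"
    using D(1) by (auto simp: big_conj)
  have "preserves n (insert x V) Sp Sn M As cs (g(x := a)) G N Bs ds (h(x := b)) H"
    by (rule preserves_representatives[OF len(1,2) F(4)]) (use b(2) in \<open>auto simp: D_def\<close>)
  with b(1) show thesis by (rule that)
qed

text \<open>The formula defining the fixed point is the conjunction, over all \<open>b \<notin> B\<close>, of the
  disjunction of the formulas of depth \<open>n\<close> that fail at \<open>(B, b)\<close>: up to equivalence this is a
  finite combination, and it fails at \<open>(A, a)\<close> exactly when some \<open>b \<notin> B\<close> satisfies at least what
  \<open>a\<close> does.\<close>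

lemma separating_formula:
  assumes len: "length As = length Bs" "length cs = length ds" "cs \<noteq> []"
  obtains \<phi> where "\<phi> \<in> fragment \<sigma> \<Sigma> W (length As) (length cs) n" "ctxt_ok V Sp Sn \<phi>"
    "\<And>h H. (h, H) \<in> K \<Longrightarrow> \<not> sat N Bs ds h H \<phi>"
    "\<And>g G. \<not> sat M As cs g G \<phi> \<Longrightarrow>
       \<exists>(h, H)\<in>K. preserves n V Sp Sn M As cs g G N Bs ds h H"
proof -
  let ?L = "fragment \<sigma> \<Sigma> W (length As) (length cs) n"
  obtain F where F: "finite F" "F \<subseteq> ?L" "\<And>\<phi>. \<phi> \<in> F \<Longrightarrow> ctxt_ok V Sp Sn \<phi>"
    "\<And>\<phi>. \<phi> \<in> ?L \<Longrightarrow> ctxt_ok V Sp Sn \<phi> \<Longrightarrow> \<exists>\<psi>\<in>F.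
       (\<forall>g G. sat M As cs g G \<psi> = sat M As cs g G \<phi>) \<and>
       (\<forall>h H. sat N Bs ds h H \<psi> = sat N Bs ds h H \<phi>)"
    using representatives[of "length As" "length cs" n V Sp Sn M As cs N Bs ds] by metis
  define fails where "fails = (\<lambda>(h, H). {\<psi> \<in> F. \<not> sat N Bs ds h H \<psi>})"
  have fails: "finite (fails w)" "fails w \<subseteq> F" for w
    using F(1) by (auto simp: fails_def split: prod.split)
  \<comment> \<open>\<open>K\<close> may be infinite, but the sets of failing representatives are
    subsets of the finite set \<open>F\<close>.\<close>
  have "finite (fails ` K)"
    by (rule finite_subset[of _ "Pow F"]) (use fails F(1) in blast)+
  then have fin: "finite (big_disj ` fails ` K)" by blast
  show thesis
  proof (rule that)
    have "\<And>w. big_disj (fails w) \<in> ?L"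
      using big_disj(2)[OF fails(1)] fails(2) F(2) len(3) by blast
    then show "big_conj (big_disj ` fails ` K) \<in> ?L"
      using big_conj(2)[OF fin] len(3) by auto
    have "\<And>w. ctxt_ok V Sp Sn (big_disj (fails w))"
      using big_disj(3)[OF fails(1)] fails(2) F(3) by blast
    then show "ctxt_ok V Sp Sn (big_conj (big_disj ` fails ` K))"
      using big_conj(3)[OF fin] by auto
    show "\<not> sat N Bs ds h H (big_conj (big_disj ` fails ` K))" if "(h, H) \<in> K" for h H
    proof -
      have "\<not> sat N Bs ds h H (big_disj (fails (h, H)))"
        unfolding big_disj(1)[OF fails(1)] by (simp add: fails_def)
      with that show ?thesis unfolding big_conj(1)[OF fin] by blast
    qed
    show "\<exists>(h, H)\<in>K. preserves n V Sp Sn M As cs g G N Bs ds h H"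
      if not: "\<not> sat M As cs g G (big_conj (big_disj ` fails ` K))" for g G
    proof -
      from not obtain h H where K: "(h, H) \<in> K" "\<not> sat M As cs g G (big_disj (fails (h, H)))"
        unfolding big_conj(1)[OF fin] by auto
      \<comment> \<open>Every representative failing at \<open>(h, H)\<close> fails at
        \<open>(g, G)\<close>: this is preservation, contraposed.\<close>
      have "preserves n V Sp Sn M As cs g G N Bs ds h H"
        by (rule preserves_representatives[OF len(1,2) F(4)])
          (use K(2)[unfolded big_disj(1)[OF fails(1)]] in \<open>auto simp: fails_def\<close>)
      with K(1) show ?thesis by blast
    qed
  qed
qed

text \<open>The separating formula of the points outside \<open>B\<close> fails at all of them, so
  \<open>B\<close> is closed under it. As \<open>B\<close> omits the value of \<open>t\<close>, the
  fixed point is false there in \<open>N\<close> and, by preservation, in \<open>M\<close>; a set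
  refuting it in \<open>M\<close> serves as \<open>A\<close>. The last conclusion, free of
  \<open>x\<close>, is for components of a fusion that do not receive the new point.\<close>

lemma preserves_Lfp_term:
  assumes pres: "preserves (Suc n) V Sp Sn M As cs g G N Bs ds h H"
    and W: "x \<in> W" "X \<in> W" and "cs \<noteq> []" and B: "B \<in> adm N"
    and t: "t \<in> terms W (length cs)" "tm_fv t \<subseteq> V" "val cs g t \<in> carr M" "val ds h t \<notin> B"
  obtains A where "A \<in> adm M" "val cs g t \<notin> A"
    "\<forall>a\<in>carr M - A. \<exists>b\<in>carr N - B. preserves n (insert x V) (insert X Sp)
       (Sn - {X}) M As cs (g(x := a)) (G(X := A)) N Bs ds (h(x := b)) (H(X := B))"
    "preserves n (V - {x}) (insert X Sp) (Sn - {X}) M As cs g (G(X := A)) N Bs ds h (H(X := B))"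
proof -
  have len: "length As = length Bs" "length cs = length ds" using pres by (auto simp: preserves_def)
  let ?K = "(\<lambda>b. (h(x := b), H(X := B))) ` (carr N - B)"
  obtain \<phi> where \<phi>: "\<phi> \<in> fragment \<sigma> \<Sigma> W (length As) (length cs) n"
    "ctxt_ok (insert x V) (insert X Sp) (Sn - {X}) \<phi>"
    "\<And>h H. (h, H) \<in> ?K \<Longrightarrow> \<not> sat N Bs ds h H \<phi>"
    "\<And>g G. \<not> sat M As cs g G \<phi> \<Longrightarrow> \<exists>(h, H)\<in>?K.
       preserves n (insert x V) (insert X Sp) (Sn - {X}) M As cs g G N Bs ds h H"
    using separating_formula[OF len \<open>cs \<noteq> []\<close>, of n "insert x V" "insert X Sp" "Sn - {X}" ?K N M]
    by metis
  have "\<not> sat N Bs ds h H (Lfp X x \<phi> t)"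
    using \<phi>(3) B t(4) by auto
  moreover have "ctxt_ok V Sp Sn (Lfp X x \<phi> t)" "positive_in X \<phi>"
    using ctxt_ok_Lfp \<phi>(2) t(2) by blast+
  moreover from this(2) have "Lfp X x \<phi> t \<in> fragment \<sigma> \<Sigma> W (length As) (length cs) (Suc n)"
    using W \<phi>(1) t(1) by simp
  ultimately have "\<not> sat M As cs g G (Lfp X x \<phi> t)"
    using preservesD[OF pres] by blast
  then obtain A where A: "A \<in> adm M" "val cs g t \<notin> A"
    "\<And>a. a \<in> carr M \<Longrightarrow> a \<notin> A \<Longrightarrow> \<not> sat M As cs (g(x := a)) (G(X := A)) \<phi>"
    unfolding sat.simps by blast
  have forth: "\<forall>a\<in>carr M - A. \<exists>b\<in>carr N - B. preserves n (insert x V) (insert X Sp)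
       (Sn - {X}) M As cs (g(x := a)) (G(X := A)) N Bs ds (h(x := b)) (H(X := B))"
  proof
    fix a assume "a \<in> carr M - A"
    then have "\<not> sat M As cs (g(x := a)) (G(X := A)) \<phi>" by (intro A(3)) auto
    from \<phi>(4)[OF this] show "\<exists>b\<in>carr N - B. preserves n (insert x V) (insert X Sp)
       (Sn - {X}) M As cs (g(x := a)) (G(X := A)) N Bs ds (h(x := b)) (H(X := B))" by auto
  qed
  have "preserves n (V - {x}) (insert X Sp) (Sn - {X}) M As cs g (G(X := A)) N Bs ds h (H(X := B))"
  proof -
    \<comment> \<open>The value of \<open>t\<close> lies outside \<open>A\<close> and so has an
      answer; forgetting \<open>x\<close> leaves preservation for the other variables.\<close>
    from forth t(3) A(2) obtain b where
      "preserves n (insert x V) (insert X Sp) (Sn - {X})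
         M As cs (g(x := val cs g t)) (G(X := A)) N Bs ds (h(x := b)) (H(X := B))" by blast
    then have "preserves n (V - {x}) (insert X Sp) (Sn - {X})
        M As cs (g(x := val cs g t)) (G(X := A)) N Bs ds (h(x := b)) (H(X := B))"
      by (rule preserves_mono) auto
    then show ?thesis by (rule preserves_cong) auto
  qed
  with A(1,2) forth show thesis by (rule that)
qed

text \<open>Meant for a component that does not own the term of the fixed point. A term to refute at
  is still required, and \<open>Cst 0\<close> is always available; if it denotes a point of
  \<open>B\<close>, the formula has to be modified.\<close>

lemma preserves_Lfp:
  assumes pres: "preserves (Suc n) V Sp Sn M As cs g G N Bs ds h H"
    and W: "x \<in> W" "X \<in> W" and "cs \<noteq> []" and B: "B \<in> adm N"
    and henkin: "lfp_henkin \<sigma> M" "lfp_henkin \<sigma> N"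
    and cs: "set cs \<subseteq> carr M" "set ds \<subseteq> carr N"
  obtains A where "A \<in> adm M"
    "\<forall>a\<in>carr M - A. \<exists>b\<in>carr N - B. preserves n (insert x V) (insert X Sp)
       (Sn - {X}) M As cs (g(x := a)) (G(X := A)) N Bs ds (h(x := b)) (H(X := B))"
    "preserves n (V - {x}) (insert X Sp) (Sn - {X}) M As cs g (G(X := A)) N Bs ds h (H(X := B))"
proof (cases "ds ! 0 \<in> B")
  case False
  have len: "length cs = length ds" using pres by (auto simp: preserves_def)
  have 0: "Cst 0 \<in> terms W (length cs)" "tm_fv (Cst 0) \<subseteq> V"
    "val cs g (Cst 0) \<in> carr M" "val ds h (Cst 0) \<notin> B"
    using cs(1) \<open>cs \<noteq> []\<close> False by auto
  show thesis by (rule preserves_Lfp_term[OF pres W \<open>cs \<noteq> []\<close> B 0]) (rule that)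
next
  case True
  txt \<open>No constant outside \<open>B\<close> is at hand. Remove the point \<open>c = ds ! 0\<close> from \<open>B\<close>, let the formula
    speak about \<open>X \<union> {c}\<close> instead of \<open>X\<close>, and use its value at \<open>c\<close> to enforce the preservation of
    the formulas not mentioning \<open>x\<close>.\<close>
  have len: "length As = length Bs" "length cs = length ds" using pres by (auto simp: preserves_def)
  have pos: "0 < length cs" using \<open>cs \<noteq> []\<close> by simp
  have cM: "cs ! 0 \<in> carr M" and cN: "ds ! 0 \<in> carr N"
    using cs len pos nth_mem by (metis subsetD)+
  let ?S = "insert X Sp" and ?T = "Sn - {X}"
  let ?K = "(\<lambda>b. (h(x := b), H(X := B))) ` (carr N - B)"
  obtain \<phi> where \<phi>: "\<phi> \<in> fragment \<sigma> \<Sigma> W (length As) (length cs) n"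
    "ctxt_ok (insert x V) ?S ?T \<phi>"
    "\<And>h H. (h, H) \<in> ?K \<Longrightarrow> \<not> sat N Bs ds h H \<phi>"
    "\<And>g G. \<not> sat M As cs g G \<phi> \<Longrightarrow> \<exists>(h, H)\<in>?K.
       preserves n (insert x V) ?S ?T M As cs g G N Bs ds h H"
    using separating_formula[OF len \<open>cs \<noteq> []\<close>, of n "insert x V" ?S ?T ?K N M] by metis
  \<comment> \<open>Separation from a single position: \<open>\<psi>\<close> fails at
    \<open>(h, H(X := B))\<close>, and wherever it fails in \<open>M\<close> the formulas without
    free \<open>x\<close> are preserved.\<close>
  obtain \<psi> where \<psi>: "\<psi> \<in> fragment \<sigma> \<Sigma> W (length As) (length cs) n"
    "ctxt_ok (V - {x}) ?S ?T \<psi>"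
    "\<And>h' H'. (h', H') \<in> {(h, H(X := B))} \<Longrightarrow> \<not> sat N Bs ds h' H' \<psi>"
    "\<And>g G. \<not> sat M As cs g G \<psi> \<Longrightarrow> \<exists>(h', H')\<in>{(h, H(X := B))}.
       preserves n (V - {x}) ?S ?T M As cs g G N Bs ds h' H'"
    using separating_formula[OF len \<open>cs \<noteq> []\<close>, of n "V - {x}" ?S ?T "{(h, H(X := B))}" N M]
    by metis
  \<comment> \<open>\<open>\<theta>\<close> states \<open>\<psi>\<close> at the constant and
    \<open>\<phi>\<close> elsewhere, both with the constant added to \<open>X\<close>, so that
    \<open>B\<close> without the constant is read as \<open>B\<close>.\<close>
  define \<theta> where "\<theta> = Disj (Conj (Eq (Var x) (Cst 0)) (add_cst X \<psi>))
    (Conj (Neg (Eq (Var x) (Cst 0))) (add_cst X \<phi>))"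
  have \<theta>: "\<theta> \<in> fragment \<sigma> \<Sigma> W (length As) (length cs) n" "ctxt_ok (insert x V) ?S ?T \<theta>"
    using \<phi>(1,2) \<psi>(1) W(1) pos ctxt_ok_mono[OF \<psi>(2), of "insert x V" ?S ?T]
    by (auto simp: \<theta>_def add_cst_in_fragment)
  have x: "x \<notin> fv \<psi>" using \<psi>(2) by (auto simp: ctxt_ok_def)
  have "\<not> sat N Bs ds h H (Lfp X x \<theta> (Cst 0))"
  proof -
    have B': "B - {ds ! 0} \<in> adm N" "insert (ds ! 0) (B - {ds ! 0}) = B"
      using lfp_henkin_insert_remove(2)[OF henkin(2) B cN] True by auto
    \<comment> \<open>Outside \<open>B - {ds ! 0}\<close> lie the constant, where
      \<open>\<theta>\<close> becomes \<open>\<psi>\<close> with \<open>X\<close> read as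
      \<open>B\<close>, and the points outside \<open>B\<close>, where it becomes
      \<open>\<phi>\<close> so read. Both fail.\<close>
    have closed: "b \<in> B - {ds ! 0}"
      if "b \<in> carr N" "sat N Bs ds (h(x := b)) (H(X := B - {ds ! 0})) \<theta>" for b
    proof (cases "b = ds ! 0")
      case True
      then show ?thesis
        using that(2) \<psi>(3) B'(2)
        by (auto simp: \<theta>_def sat_add_cst sat_upd_irrelevant[OF x])
    next
      case False
      then show ?thesis
        using that \<phi>(3) B'(2) by (auto simp: \<theta>_def sat_add_cst)
    qed
    show ?thesis
    proof
      assume "sat N Bs ds h H (Lfp X x \<theta> (Cst 0))"
      then have "ds ! 0 \<in> B - {ds ! 0}"
        unfolding sat.simps val.simps using B'(1) closed by (metis (no_types))
      then show False by simp
    qed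
  qed
  moreover have "ctxt_ok V Sp Sn (Lfp X x \<theta> (Cst 0))" "positive_in X \<theta>"
    using ctxt_ok_Lfp[of V Sp Sn X x \<theta> "Cst 0"] \<theta>(2) by simp_all
  moreover from this(2) have "Lfp X x \<theta> (Cst 0) \<in> fragment \<sigma> \<Sigma> W (length As) (length cs) (Suc n)"
    using W \<theta>(1) pos by simp
  ultimately have "\<not> sat M As cs g G (Lfp X x \<theta> (Cst 0))"
    using preservesD[OF pres] by blast
  then obtain A where A: "A \<in> adm M" "cs ! 0 \<notin> A"
    "\<And>a. a \<in> carr M \<Longrightarrow> a \<notin> A \<Longrightarrow> \<not> sat M As cs (g(x := a)) (G(X := A)) \<theta>"
    unfolding sat.simps val.simps by blast
  \<comment> \<open>\<open>\<theta>\<close> reads \<open>X\<close> with the constant added, so the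
    set wanted for \<open>\<phi>\<close> and \<open>\<psi>\<close> is \<open>?A\<close>. Since
    \<open>A\<close> omits the constant, \<open>\<theta>\<close> fails there, and hence so does
    \<open>\<psi>\<close>.\<close>
  let ?A = "insert (cs ! 0) A"
  show thesis
  proof (rule that)
    show "?A \<in> adm M" by (rule lfp_henkin_insert_remove(1)[OF henkin(1) A(1) cM])
    show "\<forall>a\<in>carr M - ?A. \<exists>b\<in>carr N - B. preserves n (insert x V) ?S ?T
       M As cs (g(x := a)) (G(X := ?A)) N Bs ds (h(x := b)) (H(X := B))"
    proof
      fix a assume a: "a \<in> carr M - ?A"
      have "\<not> sat M As cs (g(x := a)) (G(X := ?A)) \<phi>"
        using A(3)[of a] a by (simp add: \<theta>_def sat_add_cst)
      from \<phi>(4)[OF this] show "\<exists>b\<in>carr N - B. preserves n (insert x V) ?S ?T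
        M As cs (g(x := a)) (G(X := ?A)) N Bs ds (h(x := b)) (H(X := B))" by auto
    qed
    have "\<not> sat M As cs g (G(X := ?A)) \<psi>"
      using A(3)[OF cM A(2)] by (simp add: \<theta>_def sat_add_cst sat_upd_irrelevant[OF x])
    from \<psi>(4)[OF this]
    show "preserves n (V - {x}) ?S ?T M As cs g (G(X := ?A)) N Bs ds h (H(X := B))" by simp
  qed
qed

end


section \<open>Comparing fusions\<close>

lemma terms_Int: "terms (V \<inter> W) c \<subseteq> terms V c"
  by (auto simp: terms_def)

text \<open>Places (component, local index) in the order of \<open>join\<close>. The list depends on
  the lengths alone, so both fusions share it.\<close>

definition positions :: "nat \<Rightarrow> (nat \<Rightarrow> nat) \<Rightarrow> (nat \<times> nat) list" where
  "positions k l = concat (map (\<lambda>i. map (Pair i) [0..<l i]) [1..<Suc k])"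

lemma set_positions: "(i, j) \<in> set (positions k l) \<longleftrightarrow> i \<in> {1..k} \<and> j < l i"
  by (auto simp: positions_def)

lemma join_positions:
  assumes "\<And>i. i \<in> {1..k} \<Longrightarrow> length (s i) = l i"
  shows "join k s = map (\<lambda>(i, j). s i ! j) (positions k l)"
proof -
  have local: "map s [1..<Suc k] = map (\<lambda>i. map (\<lambda>j. s i ! j) [0..<l i]) [1..<Suc k]"
  proof (rule map_cong[OF refl])
    fix i assume "i \<in> set [1..<Suc k]"
    then have "length (s i) = l i" by (intro assms) auto
    then show "s i = map (\<lambda>j. s i ! j) [0..<l i]" using map_nth[of "s i"] by simp
  qed
  show ?thesis
    unfolding join_def local by (simp add: positions_def map_concat o_def del: upt_Suc)
qed

lemma subseqs_map: "subseqs (map f xs) = map (map f) (subseqs xs)"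
  by (induction xs) (auto simp: Let_def)

text \<open>\<open>subseqs\<close> commutes with \<open>map\<close>, so each union is indexed by a
  sublist of places, the same for every family of sets with these lengths.\<close>

lemma all_unions_join:
  assumes "\<And>i. i \<in> {1..k} \<Longrightarrow> length (A i) = l i"
  shows "all_unions (join k A) =
    map (\<lambda>I. \<Union>(i, j)\<in>set I. A i ! j) (subseqs (positions k l))"
proof -
  have "join k A = map (\<lambda>(i, j). A i ! j) (positions k l)"
    by (rule join_positions) (rule assms)
  then show ?thesis by (simp add: all_unions_def subseqs_map o_def case_prod_beta)
qed

lemma fusion_simps:
  "carr (fusion \<sigma> f k M) = (\<Union>i\<in>{1..k}. carr (M i))"
  "adm (fusion \<sigma> f k M) = {\<Union>i\<in>{1..k}. A i | A. \<forall>i\<in>{1..k}. A i \<in> adm (M i)}"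
  by (simp_all add: fusion_def disjoint_union_def)

section \<open>Locating the terms of a fusion in its components\<close>

locale fusion_comparison = finite_language \<sigma> \<Sigma> W
  for \<sigma> :: "'p voc" and \<Sigma> W +
  fixes f :: "'p \<Rightarrow> ('p + nat) fm" and k :: nat and la lA :: "nat \<Rightarrow> nat"
begin

definition component_family ::
    "(nat \<Rightarrow> ('a, 'p) frame) \<Rightarrow> (nat \<Rightarrow> 'a set list) \<Rightarrow> (nat \<Rightarrow> 'a list) \<Rightarrow> bool" where
  "component_family M A a \<longleftrightarrow> disjoint_family_on (\<lambda>i. carr (M i)) {1..k} \<and>
     (\<forall>i\<in>{1..k}. lfp_henkin \<sigma> (M i) \<and> length (A i) = lA i \<and> length (a i) = la i \<and>
        a i \<noteq> [] \<and> set (a i) \<subseteq> carr (M i) \<and> set (A i) \<subseteq> adm (M i))"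

abbreviation "cst_count \<equiv> length (positions k la)"
abbreviation "set_count \<equiv> length (subseqs (positions k lA))"

text \<open>\<open>own\<close> says in which component a variable takes its value; for a constant
  this is settled by its place.\<close>

definition owner :: "(nat \<Rightarrow> nat) \<Rightarrow> tm \<Rightarrow> nat" where
  "owner own t = (case t of Var x \<Rightarrow> own x | Cst j \<Rightarrow> fst (positions k la ! j))"

definition local_tm :: "tm \<Rightarrow> tm" where
  "local_tm t = (case t of Var x \<Rightarrow> Var x | Cst j \<Rightarrow> Cst (snd (positions k la ! j)))"

definition placed :: "nat set \<Rightarrow> (nat \<Rightarrow> nat) \<Rightarrow> (nat \<Rightarrow> ('a, 'p) frame) \<Rightarrow> (nat \<Rightarrow> 'a) \<Rightarrow> bool" where
  "placed V own M g \<longleftrightarrow> (\<forall>x\<in>V. own x \<in> {1..k} \<and> g x \<in> carr (M (own x)))"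

lemma component_carr_eq:
  assumes "component_family M A a" "i \<in> {1..k}" "j \<in> {1..k}" "c \<in> carr (M i)" "c \<in> carr (M j)"
  shows "i = j"
  using assms unfolding component_family_def disjoint_family_on_def by blast

lemma component_adm:
  assumes "component_family M A a" "i \<in> {1..k}" "C \<in> adm (M i)"
  shows "C \<subseteq> carr (M i)"
  using assms unfolding component_family_def lfp_henkin_def is_frame_def by blast

lemma local_tm_in_terms:
  assumes "t \<in> terms (V \<inter> W) cst_count"
  shows "local_tm t \<in> terms W (la (owner own t))"
    "tm_fv (local_tm t) \<subseteq> {x \<in> V. own x = owner own t}"
proof -
  have "j < length (positions k la) \<Longrightarrow>
      snd (positions k la ! j) < la (fst (positions k la ! j))" for j
    using set_positions nth_mem by (metis prod.collapse)
  with assms show "local_tm t \<in> terms W (la (owner own t))"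
    "tm_fv (local_tm t) \<subseteq> {x \<in> V. own x = owner own t}"
    by (auto simp: terms_def local_tm_def owner_def split: tm.splits)
qed

lemma val_join:
  assumes "component_family M A a" "placed V own M g" "t \<in> terms V cst_count"
  shows "owner own t \<in> {1..k}"
    "val (join k a) g t = val (a (owner own t)) g (local_tm t)"
    "val (a (owner own t)) g (local_tm t) \<in> carr (M (owner own t))"
proof -
  have len: "\<And>i. i \<in> {1..k} \<Longrightarrow> length (a i) = la i"
    using assms(1) by (simp add: component_family_def)
  have "owner own t \<in> {1..k} \<and> val (join k a) g t = val (a (owner own t)) g (local_tm t) \<and>
    val (a (owner own t)) g (local_tm t) \<in> carr (M (owner own t))"
  proof (cases t)
    case (Var x)
    with assms(2,3) show ?thesis by (auto simp: placed_def owner_def local_tm_def)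
  next
    case (Cst j)
    obtain i l where il: "positions k la ! j = (i, l)" by fastforce
    have j: "j < length (positions k la)" using assms(3) Cst by simp
    then have "(i, l) \<in> set (positions k la)" using il nth_mem by metis
    then have i: "i \<in> {1..k}" "l < la i" by (simp_all add: set_positions)
    with len have "a i ! l \<in> set (a i)" by simp
    with i(1) assms(1) have "a i ! l \<in> carr (M i)" by (auto simp: component_family_def)
    moreover have "join k a = map (\<lambda>(i, j). a i ! j) (positions k la)"
      by (rule join_positions) (rule len)
    ultimately show ?thesis
      using i il j Cst by (simp add: owner_def local_tm_def)
  qed
  then show "owner own t \<in> {1..k}"
    "val (join k a) g t = val (a (owner own t)) g (local_tm t)"
    "val (a (owner own t)) g (local_tm t) \<in> carr (M (owner own t))" by blast+
qed

lemma val_join_in_carr_iff: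
  assumes "component_family M A a" "placed V own M g" "t \<in> terms V cst_count" "i \<in> {1..k}"
  shows "val (join k a) g t \<in> carr (M i) \<longleftrightarrow> owner own t = i"
  using val_join[OF assms(1-3)] component_carr_eq[OF assms(1)] assms(4) by metis

text \<open>Tuples of a component relation stay within its carrier, and carriers are disjoint, so
  only a component owning all the terms can contribute. For an empty list of terms the ownership
  condition is vacuous and any component may.\<close>

lemma map_val_join_in_rel_iff:
  assumes fam: "component_family M A a" "placed V own M g" and ts: "set ts \<subseteq> terms V cst_count"
    and P: "\<sigma> P = Some (length ts)"
  shows "map (val (join k a) g) ts \<in> (\<Union>i\<in>{1..k}. rel (M i) P) \<longleftrightarrow>
    (\<exists>i\<in>{1..k}. (\<forall>t\<in>set ts. owner own t = i) \<and>
       map (val (a i) g) (map local_tm ts) \<in> rel (M i) P)"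
proof -
  have "map (val (join k a) g) ts \<in> rel (M i) P \<longleftrightarrow>
     (\<forall>t\<in>set ts. owner own t = i) \<and> map (val (a i) g) (map local_tm ts) \<in> rel (M i) P"
    if i: "i \<in> {1..k}" for i
  proof -
    have "\<forall>t\<in>set ts. owner own t = i" if "map (val (join k a) g) ts \<in> rel (M i) P"
    proof -
      have "set (map (val (join k a) g) ts) \<subseteq> carr (M i)"
        using that fam(1) i P unfolding component_family_def lfp_henkin_def is_frame_def by blast
      then show ?thesis using val_join_in_carr_iff[OF fam _ i] ts by auto
    qed
    moreover have "map (val (join k a) g) ts = map (val (a i) g) (map local_tm ts)"
      if "\<forall>t\<in>set ts. owner own t = i"
      using that ts val_join(2)[OF fam] by auto
    ultimately show ?thesis by (metis (no_types, lifting))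
  qed
  then show ?thesis by blast
qed

text \<open>The components share the assignments \<open>g\<close> and \<open>h\<close>; component \<open>i\<close> sees only the variables
  \<open>x\<close> with \<open>own x = i\<close>.\<close>

definition linked :: "nat \<Rightarrow> nat set \<Rightarrow> nat set \<Rightarrow> nat set \<Rightarrow> (nat \<Rightarrow> nat) \<Rightarrow>
    (nat \<Rightarrow> ('a, 'p) frame) \<Rightarrow> (nat \<Rightarrow> 'a set list) \<Rightarrow> (nat \<Rightarrow> 'a list) \<Rightarrow>
    (nat \<Rightarrow> 'a) \<Rightarrow> (nat \<Rightarrow> 'a set) \<Rightarrow> (nat \<Rightarrow> nat \<Rightarrow> 'a set) \<Rightarrow>
    (nat \<Rightarrow> ('b, 'p) frame) \<Rightarrow> (nat \<Rightarrow> 'b set list) \<Rightarrow> (nat \<Rightarrow> 'b list) \<Rightarrow>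
    (nat \<Rightarrow> 'b) \<Rightarrow> (nat \<Rightarrow> 'b set) \<Rightarrow> (nat \<Rightarrow> nat \<Rightarrow> 'b set) \<Rightarrow> bool" where
  "linked n V Sp Sn own M A a g G Gs N B b h H Hs \<longleftrightarrow>
     component_family M A a \<and> component_family N B b \<and> placed V own M g \<and> placed V own N h \<and>
     (\<forall>i\<in>{1..k}.
        (\<forall>X\<in>Sp \<union> Sn. G X \<inter> carr (M i) = Gs i X \<inter> carr (M i) \<and>
                      H X \<inter> carr (N i) = Hs i X \<inter> carr (N i)) \<and>
        preserves n {x \<in> V. own x = i} Sp Sn
          (M i) (A i) (a i) g (Gs i) (N i) (B i) (b i) h (Hs i))"

lemma linked_swap:
  "linked n V Sp Sn own M A a g G Gs N B b h H Hs \<Longrightarrow>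
   linked n V Sn Sp own N B b h H Hs M A a g G Gs"
  unfolding linked_def by (auto intro: preserves_swap)

section \<open>Agreement of linked positions on atomic formulas\<close>

context
  fixes n V Sp Sn own
    and M :: "nat \<Rightarrow> ('a, 'p) frame" and A a g G Gs
    and N :: "nat \<Rightarrow> ('b, 'p) frame" and B b h H Hs
  assumes linked: "linked n V Sp Sn own M A a g G Gs N B b h H Hs"
begin

lemma linked_family: "component_family M A a" "component_family N B b"
    "placed V own M g" "placed V own N h"
  using linked by (simp_all add: linked_def)

lemma linked_lengths:
  assumes "i \<in> {1..k}"
  shows "length (A i) = lA i" "length (a i) = la i" "length (B i) = lA i" "length (b i) = la i"
  using linked_family(1,2) assms by (simp_all add: component_family_def)

lemma linked_imp:
  assumes "i \<in> {1..k}" "\<phi> \<in> fragment \<sigma> \<Sigma> W (lA i) (la i) n" "ctxt_ok {x \<in> V. own x = i} Sp Sn \<phi>"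
    "sat (M i) (A i) (a i) g (Gs i) \<phi>"
  shows "sat (N i) (B i) (b i) h (Hs i) \<phi>"
proof -
  have "preserves n {x \<in> V. own x = i} Sp Sn
      (M i) (A i) (a i) g (Gs i) (N i) (B i) (b i) h (Hs i)"
    using linked assms(1) by (simp add: linked_def)
  from preservesD[OF this _ assms(3,4)] show ?thesis
    using assms(2) linked_lengths[OF assms(1)] by simp
qed

text \<open>Without free set variables, the negation of a formula respects the same polarity
  lists.\<close>

lemma linked_iff:
  assumes "i \<in> {1..k}" "\<phi> \<in> fragment \<sigma> \<Sigma> W (lA i) (la i) n" "ctxt_ok {x \<in> V. own x = i} {} {} \<phi>"
  shows "sat (M i) (A i) (a i) g (Gs i) \<phi> \<longleftrightarrow> sat (N i) (B i) (b i) h (Hs i) \<phi>"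
proof -
  have "ctxt_ok {x \<in> V. own x = i} Sp Sn \<phi>" "ctxt_ok {x \<in> V. own x = i} Sp Sn (Neg \<phi>)"
    using ctxt_ok_mono[OF assms(3)] by simp_all
  then show ?thesis
    using linked_imp[OF assms(1), of \<phi>] linked_imp[OF assms(1), of "Neg \<phi>"] assms(2) by auto
qed

text \<open>Terms with the same owner are compared inside that component; terms with different
  owners differ on both sides by disjointness.\<close>

lemma linked_eq_iff:
  assumes "s \<in> terms (V \<inter> W) cst_count" "t \<in> terms (V \<inter> W) cst_count"
  shows "val (join k a) g s = val (join k a) g t \<longleftrightarrow> val (join k b) h s = val (join k b) h t"
proof -
  have st: "s \<in> terms V cst_count" "t \<in> terms V cst_count"
    using assms by (auto simp: terms_def)
  note vM = val_join[OF linked_family(1,3)] and vN = val_join[OF linked_family(2,4)]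
  show ?thesis
  proof (cases "owner own s = owner own t")
    case True
    have "sat (M i) (A i) (a i) g (Gs i) (Eq (local_tm s) (local_tm t)) \<longleftrightarrow>
        sat (N i) (B i) (b i) h (Hs i) (Eq (local_tm s) (local_tm t))" if "i = owner own t" for i
    proof (rule linked_iff)
      show "i \<in> {1..k}" using vM(1)[OF st(2)] that by simp
    qed (use local_tm_in_terms[OF assms(1), of own] local_tm_in_terms[OF assms(2), of own]
        True that in auto)
    then show ?thesis using vM(2) vN(2) st True by simp
  next
    case False
    then have "val (join k a) g s \<noteq> val (join k a) g t"
      using vM st component_carr_eq[OF linked_family(1)] by metis
    moreover have "val (join k b) h s \<noteq> val (join k b) h t"
      using vN st component_carr_eq[OF linked_family(2)] False by metis
    ultimately show ?thesis by blast
  qed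
qed

lemma linked_rel_iff:
  assumes ts: "set ts \<subseteq> terms (V \<inter> W) cst_count" and P: "\<sigma> P = Some (length ts)" "P \<in> \<Sigma>"
  shows "map (val (join k a) g) ts \<in> (\<Union>i\<in>{1..k}. rel (M i) P) \<longleftrightarrow>
    map (val (join k b) h) ts \<in> (\<Union>i\<in>{1..k}. rel (N i) P)"
proof -
  have ts': "set ts \<subseteq> terms V cst_count" by (rule order_trans[OF ts terms_Int])
  have local: "map (val (a i) g) (map local_tm ts) \<in> rel (M i) P \<longleftrightarrow>
      map (val (b i) h) (map local_tm ts) \<in> rel (N i) P"
    if "i \<in> {1..k}" "\<forall>t\<in>set ts. owner own t = i" for i
  proof -
    have "local_tm t \<in> terms W (la i)" "tm_fv (local_tm t) \<subseteq> {x \<in> V. own x = i}"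
      if "t \<in> set ts" for t
      using local_tm_in_terms[of t V own] ts \<open>\<forall>t\<in>set ts. owner own t = i\<close> that by auto
    then have "set (map local_tm ts) \<subseteq> terms W (la i)"
      "(\<Union>t\<in>set (map local_tm ts). tm_fv t) \<subseteq> {x \<in> V. own x = i}" by auto
    then have "sat (M i) (A i) (a i) g (Gs i) (Rel P (map local_tm ts)) \<longleftrightarrow>
        sat (N i) (B i) (b i) h (Hs i) (Rel P (map local_tm ts))"
      using P by (intro linked_iff[OF that(1)]) simp_all
    then show ?thesis by (simp only: sat.simps)
  qed
  show ?thesis
    unfolding map_val_join_in_rel_iff[OF linked_family(1,3) ts' P(1)]
      map_val_join_in_rel_iff[OF linked_family(2,4) ts' P(1)]
    by (rule bex_cong[OF refl], rule conj_cong[OF refl], rule local)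
qed

text \<open>A quantifier-free formula without set variables is a Boolean combination of atoms, and
  each atom is decided by the owners of its terms together with atoms of a single component.\<close>

lemma linked_disjoint_union_iff:
  assumes ts: "set ts \<subseteq> terms (V \<inter> W) cst_count"
    and "lfp_formula (star_voc k \<sigma>) 0 0 \<psi>" "qf_fo \<psi>" "fv \<psi> \<subseteq> {..<length ts}"
    and "{Q. Inl Q \<in> set_fm \<psi>} \<subseteq> \<Sigma>"
  shows "sat (disjoint_union k M) [] [] ((!) (map (val (join k a) g) ts)) (\<lambda>_. {}) \<psi> \<longleftrightarrow>
    sat (disjoint_union k N) [] [] ((!) (map (val (join k b) h) ts)) (\<lambda>_. {}) \<psi>"
proof -
  \<comment> \<open>Variable \<open>i\<close> of the fusion formula stands for entry
    \<open>i\<close> of the tuple, hence for the term \<open>ts ! i\<close>. The \<open>Cst\<close>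
    branch is a default value, as \<open>\<psi>\<close> has no constants.\<close>
  define sub where "sub u = (case u of Var i \<Rightarrow> ts ! i | Cst j \<Rightarrow> Cst j)" for u
  have sub: "sub u \<in> terms (V \<inter> W) cst_count"
    "val [] ((!) (map v ts)) u = v (sub u)"
    if "wf_tm 0 u" "tm_fv u \<subseteq> {..<length ts}" for u and v :: "tm \<Rightarrow> 'c"
    using that ts nth_mem by (auto simp: sub_def split: tm.splits)
  show ?thesis using assms(2-)
  proof (induction \<psi>)
    case (Rel s us)
    have us: "wf_tm 0 u" "tm_fv u \<subseteq> {..<length ts}" if "u \<in> set us" for u
      using Rel that by auto
    show ?case
    proof (cases s)
      case (Inl P)
      have "set (map sub us) \<subseteq> terms (V \<inter> W) cst_count" using sub(1) us by auto
      moreover have "\<sigma> P = Some (length (map sub us))" "P \<in> \<Sigma>"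
        using Rel Inl by (auto simp: star_voc_def)
      ultimately show ?thesis
        using linked_rel_iff[of "map sub us" P] us Inl
        by (simp add: disjoint_union_def sub(2) o_def cong: map_cong)
    next
      \<comment> \<open>The predicate \<open>Inr j\<close> asks whether component \<open>j\<close>
        owns the term, and \<open>own\<close> is common to both sides.\<close>
      case (Inr j)
      with Rel have j: "j \<in> {1..k}" and "length us = 1"
        by (auto simp: star_voc_def split: if_splits)
      then obtain u where u: "us = [u]" by (auto simp: length_Suc_conv)
      then have "sub u \<in> terms V cst_count" using sub(1)[of u] us by (auto simp: terms_def)
      then have "val (join k a) g (sub u) \<in> carr (M j) \<longleftrightarrow>
          val (join k b) h (sub u) \<in> carr (N j)"
        using val_join_in_carr_iff[OF linked_family(1,3) _ j]
          val_join_in_carr_iff[OF linked_family(2,4) _ j] by simp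
      then show ?thesis
        using us j u Inr by (auto simp: disjoint_union_def sub(2))
    qed
  next
    case (Eq s t)
    then show ?case
      using linked_eq_iff[of "sub s" "sub t"] by (simp add: sub)
  next
    case (Conj \<psi> \<chi>)
    have "{Q. Inl Q \<in> set_fm \<psi>} \<subseteq> \<Sigma>" "{Q. Inl Q \<in> set_fm \<chi>} \<subseteq> \<Sigma>"
      using Conj.prems(4) by (simp_all add: subset_iff)
    with Conj show ?case by simp
  qed simp_all
qed

lemma linked_Rel_iff:
  assumes "fusion_map k \<sigma> f"
    and P: "\<sigma> P = Some (length ts)" "{Q. Inl Q \<in> set_fm (f P)} \<subseteq> \<Sigma>"
    and ts: "set ts \<subseteq> terms (V \<inter> W) cst_count"
  shows "map (val (join k a) g) ts \<in> rel (fusion \<sigma> f k M) P \<longleftrightarrow>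
    map (val (join k b) h) ts \<in> rel (fusion \<sigma> f k N) P"
proof -
  have fP: "lfp_formula (star_voc k \<sigma>) 0 0 (f P)" "qf_fo (f P)" "fv (f P) \<subseteq> {..<length ts}"
    using assms(1) P(1) unfolding fusion_map_def by blast+
  have ts': "t \<in> terms V cst_count" if "t \<in> set ts" for t
    by (rule subsetD[OF order_trans[OF ts terms_Int] that])
  have "set (map (val (join k a) g) ts) \<subseteq> carr (disjoint_union k M)"
    using ts' val_join[OF linked_family(1,3)] by (fastforce simp: disjoint_union_def)
  moreover have "set (map (val (join k b) h) ts) \<subseteq> carr (disjoint_union k N)"
    using ts' val_join[OF linked_family(2,4)] by (fastforce simp: disjoint_union_def)
  ultimately show ?thesis
    using linked_disjoint_union_iff[OF ts fP P(2)] P(1) by (simp add: fusion_def)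
qed

end

lemma linked_SVar:
  assumes linked: "linked n V Sp Sn own M A a g G Gs N B b h H Hs"
    and X: "X \<in> Sp" "X \<in> W"
    and t: "t \<in> terms (V \<inter> W) cst_count" and GX: "val (join k a) g t \<in> G X"
  shows "val (join k b) h t \<in> H X"
proof -
  note fam = linked_family[OF linked]
  have t': "t \<in> terms V cst_count" by (rule subsetD[OF terms_Int t])
  define i where "i = owner own t"
  note vM = val_join[OF fam(1,3) t', folded i_def]
  note vN = val_join[OF fam(2,4) t', folded i_def]
  have GH: "G X \<inter> carr (M i) = Gs i X \<inter> carr (M i)" "H X \<inter> carr (N i) = Hs i X \<inter> carr (N i)"
    using linked X(1) vM(1) by (auto simp: linked_def)
  have "sat (N i) (B i) (b i) h (Hs i) (SVar X (local_tm t))"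
  proof (rule linked_imp[OF linked])
    show "i \<in> {1..k}" by (rule vM(1))
    show "SVar X (local_tm t) \<in> fragment \<sigma> \<Sigma> W (lA i) (la i) n"
      "ctxt_ok {x \<in> V. own x = i} Sp Sn (SVar X (local_tm t))"
      using local_tm_in_terms[OF t, of own] X by (simp_all add: i_def)
    show "sat (M i) (A i) (a i) g (Gs i) (SVar X (local_tm t))"
      using GX vM(2,3) GH(1) by auto
  qed
  with vN(2,3) GH(2) show ?thesis by auto
qed

text \<open>Admissible sets lie in their own carriers, so among the sets of a union only those from
  the owner of \<open>t\<close> can contain its value.\<close>

lemma val_join_in_union_iff:
  assumes fam: "component_family M A a" "placed V own M g" and t: "t \<in> terms V cst_count"
    and j: "j < set_count"
  shows "val (join k a) g t \<in> all_unions (join k A) ! j \<longleftrightarrow>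
    (\<exists>l. (owner own t, l) \<in> set (subseqs (positions k lA) ! j) \<and>
       val (a (owner own t)) g (local_tm t) \<in> A (owner own t) ! l)"
proof -
  let ?I = "subseqs (positions k lA) ! j"
  have len: "\<And>i. i \<in> {1..k} \<Longrightarrow> length (A i) = lA i"
    using fam(1) by (simp add: component_family_def)
  have "all_unions (join k A) = map (\<lambda>I. \<Union>(i, j)\<in>set I. A i ! j) (subseqs (positions k lA))"
    by (rule all_unions_join) (rule len)
  then have un: "all_unions (join k A) ! j = (\<Union>(i, l)\<in>set ?I. A i ! l)"
    using j by simp
  have "?I \<in> set (subseqs (positions k lA))" using j by (rule nth_mem)
  then have "set ?I \<in> Pow (set (positions k lA))" unfolding subseqs_powset[symmetric] by blast
  then have I: "i \<in> {1..k} \<and> l < lA i" if "(i, l) \<in> set ?I" for i l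
    using that set_positions by blast
  have "i = owner own t" if "(i, l) \<in> set ?I" "val (join k a) g t \<in> A i ! l" for i l
  proof -
    have "A i ! l \<in> set (A i)" using I[OF that(1)] len by simp
    then have "A i ! l \<subseteq> carr (M i)"
      using component_adm[OF fam(1)] fam(1) I[OF that(1)] unfolding component_family_def by blast
    then show ?thesis
      using val_join_in_carr_iff[OF fam t] I[OF that(1)] that(2) by blast
  qed
  then show ?thesis
    unfolding un using val_join(2)[OF fam t] by fastforce
qed

lemma linked_SPar_iff:
  assumes linked: "linked n V Sp Sn own M A a g G Gs N B b h H Hs"
    and t: "t \<in> terms (V \<inter> W) cst_count" and j: "j < set_count"
  shows "val (join k a) g t \<in> all_unions (join k A) ! j \<longleftrightarrow>
    val (join k b) h t \<in> all_unions (join k B) ! j"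
proof -
  note fam = linked_family[OF linked]
  have t': "t \<in> terms V cst_count" by (rule subsetD[OF terms_Int t])
  define i where "i = owner own t"
  have i: "i \<in> {1..k}" using val_join(1)[OF fam(1,3) t'] by (simp add: i_def)
  let ?I = "subseqs (positions k lA) ! j"
  have "?I \<in> set (subseqs (positions k lA))" using j by (rule nth_mem)
  then have "set ?I \<in> Pow (set (positions k lA))" unfolding subseqs_powset[symmetric] by blast
  then have I: "l < lA i" if "(i, l) \<in> set ?I" for l
    using that set_positions by blast
  have "val (a i) g (local_tm t) \<in> A i ! l \<longleftrightarrow> val (b i) h (local_tm t) \<in> B i ! l"
    if "(i, l) \<in> set ?I" for l
  proof -
    have "sat (M i) (A i) (a i) g (Gs i) (SPar l (local_tm t)) \<longleftrightarrow>
        sat (N i) (B i) (b i) h (Hs i) (SPar l (local_tm t))"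
      using I[OF that] local_tm_in_terms[OF t, of own]
      by (intro linked_iff[OF linked i]) (simp_all add: i_def)
    then show ?thesis by simp
  qed
  then show ?thesis
    unfolding val_join_in_union_iff[OF fam(1,3) t' j] val_join_in_union_iff[OF fam(2,4) t' j]
    by (simp only: i_def cong: conj_cong)
qed

section \<open>Quantifier and fixed point steps for fusions, and the induction on formulas\<close>

lemma placed_upd:
  assumes "placed V own M g" "i \<in> {1..k}" "c \<in> carr (M i)"
  shows "placed (insert x V) (own(x := i)) M (g(x := c))"
  using assms by (auto simp: placed_def)

text \<open>Giving \<open>x\<close> to component \<open>i\<close> hides it from all others; this is
  why the component lemmas offer preservation for \<open>V - {x}\<close>.\<close>

lemma owned_upd:
  "{y \<in> insert x V. (own(x := i)) y = i} = insert x {y \<in> V. own y = i}"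
  "j \<noteq> i \<Longrightarrow> {y \<in> insert x V. (own(x := i)) y = j} = {y \<in> V. own y = j} - {x}"
  by auto

text \<open>Only the component containing \<open>c\<close> has to answer. The others forget the old
  value of \<open>x\<close>, which weakens what is demanded of them.\<close>

lemma linked_Ex:
  assumes linked: "linked (Suc n) V Sp Sn own M A a g G Gs N B b h H Hs"
    and "x \<in> W" "c \<in> carr (fusion \<sigma> f k M)"
  obtains d own' where "d \<in> carr (fusion \<sigma> f k N)"
    "linked n (insert x V) Sp Sn own' M A a (g(x := c)) G Gs N B b (h(x := d)) H Hs"
proof -
  note fam = linked_family[OF linked]
  have pres: "preserves (Suc n) {y \<in> V. own y = i} Sp Sn
      (M i) (A i) (a i) g (Gs i) (N i) (B i) (b i) h (Hs i)" if "i \<in> {1..k}" for i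
    using linked that by (simp add: linked_def)
  obtain i where i: "i \<in> {1..k}" "c \<in> carr (M i)"
    using assms(3) by (auto simp: fusion_simps)
  have "a i \<noteq> []" using fam(1) i(1) by (simp add: component_family_def)
  from preserves_Ex[OF pres[OF i(1)] \<open>x \<in> W\<close> i(2) this]
  obtain d where d: "d \<in> carr (N i)" and
    pres_d: "preserves n (insert x {y \<in> V. own y = i}) Sp Sn
      (M i) (A i) (a i) (g(x := c)) (Gs i) (N i) (B i) (b i) (h(x := d)) (Hs i)" .
  have "preserves n {y \<in> insert x V. (own(x := i)) y = j} Sp Sn
      (M j) (A j) (a j) (g(x := c)) (Gs j) (N j) (B j) (b j) (h(x := d)) (Hs j)"
    if "j \<in> {1..k}" for j
  proof (cases "j = i")
    case True
    from pres_d show ?thesis unfolding True owned_upd(1) .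
  next
    case False
    have "preserves n ({y \<in> V. own y = j} - {x}) Sp Sn
        (M j) (A j) (a j) g (Gs j) (N j) (B j) (b j) h (Hs j)"
      by (rule preserves_mono[OF pres[OF that]]) auto
    then have "preserves n ({y \<in> V. own y = j} - {x}) Sp Sn
        (M j) (A j) (a j) (g(x := c)) (Gs j) (N j) (B j) (b j) (h(x := d)) (Hs j)"
      by (rule preserves_cong) auto
    then show ?thesis unfolding owned_upd(2)[OF False] .
  qed
  then have "linked n (insert x V) Sp Sn (own(x := i)) M A a (g(x := c)) G Gs
      N B b (h(x := d)) H Hs"
    using linked placed_upd[OF fam(3) i] placed_upd[OF fam(4) i(1) d] unfolding linked_def by simp
  moreover have "d \<in> carr (fusion \<sigma> f k N)" using d i(1) by (auto simp: fusion_simps)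
  ultimately show thesis by (intro that)
qed

lemma union_Int_component:
  assumes "component_family M A a" "\<And>i. i \<in> {1..k} \<Longrightarrow> C i \<in> adm (M i)" "i \<in> {1..k}"
  shows "(\<Union>i\<in>{1..k}. C i) \<inter> carr (M i) = C i"
proof
  show "(\<Union>i\<in>{1..k}. C i) \<inter> carr (M i) \<subseteq> C i"
  proof
    fix c assume "c \<in> (\<Union>i\<in>{1..k}. C i) \<inter> carr (M i)"
    then obtain j where j: "j \<in> {1..k}" "c \<in> C j" "c \<in> carr (M i)" by blast
    then have "c \<in> carr (M j)" using component_adm[OF assms(1) j(1) assms(2)[OF j(1)]] by blast
    then have "j = i" using component_carr_eq[OF assms(1) j(1) assms(3)] j(3) by blast
    with j(2) show "c \<in> C i" by simp
  qed
  show "C i \<subseteq> (\<Union>i\<in>{1..k}. C i) \<inter> carr (M i)"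
    using component_adm[OF assms(1,3) assms(2)[OF assms(3)]] assms(3) by blast
qed

text \<open>The components answer the parts of \<open>D\<close> separately, the owner of
  \<open>t\<close> by refuting at its local copy of \<open>t\<close>. A point outside the union
  \<open>C\<close> lies in one component, outside its part, and is answered there; the other
  components rely on the preservation without \<open>x\<close>.\<close>

lemma linked_Lfp:
  assumes linked: "linked (Suc n) V Sp Sn own M A a g G Gs N B b h H Hs"
    and W: "x \<in> W" "X \<in> W" and t: "t \<in> terms (V \<inter> W) cst_count"
    and D: "D \<in> adm (fusion \<sigma> f k N)" "val (join k b) h t \<notin> D"
  obtains C where "C \<in> adm (fusion \<sigma> f k M)" "val (join k a) g t \<notin> C"
    "\<forall>c\<in>carr (fusion \<sigma> f k M) - C. \<exists>d\<in>carr (fusion \<sigma> f k N) - D. \<exists>own' Gs' Hs'.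
       linked n (insert x V) (insert X Sp) (Sn - {X}) own' M A a (g(x := c)) (G(X := C)) Gs'
         N B b (h(x := d)) (H(X := D)) Hs'"
proof -
  note fam = linked_family[OF linked]
  have t': "t \<in> terms V cst_count" by (rule subsetD[OF terms_Int t])
  note vM = val_join[OF fam(1,3) t'] and vN = val_join[OF fam(2,4) t']
  obtain Ds where Ds: "D = (\<Union>i\<in>{1..k}. Ds i)" "\<And>i. i \<in> {1..k} \<Longrightarrow> Ds i \<in> adm (N i)"
    using D(1) by (auto simp: fusion_simps)
  let ?V = "\<lambda>i. {y \<in> V. own y = i}" and ?S = "insert X Sp" and ?T = "Sn - {X}"
  \<comment> \<open>The demands on the answer of component \<open>i\<close>. Omission of the term,
    the last clause, concerns only the owner of \<open>t\<close>.\<close>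
  let ?good = "\<lambda>i Ci. Ci \<in> adm (M i) \<and>
     (\<forall>c\<in>carr (M i) - Ci. \<exists>d\<in>carr (N i) - Ds i. preserves n (insert x (?V i)) ?S ?T
        (M i) (A i) (a i) (g(x := c)) ((Gs i)(X := Ci))
        (N i) (B i) (b i) (h(x := d)) ((Hs i)(X := Ds i))) \<and>
     preserves n (?V i - {x}) ?S ?T
       (M i) (A i) (a i) g ((Gs i)(X := Ci)) (N i) (B i) (b i) h ((Hs i)(X := Ds i)) \<and>
     (owner own t = i \<longrightarrow> val (join k a) g t \<notin> Ci)"
  have "\<exists>Ci. ?good i Ci" if i: "i \<in> {1..k}" for i
  proof -
    have pres: "preserves (Suc n) (?V i) Sp Sn
        (M i) (A i) (a i) g (Gs i) (N i) (B i) (b i) h (Hs i)"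
      using linked i by (simp add: linked_def)
    have comp: "a i \<noteq> []" "length (a i) = la i" "lfp_henkin \<sigma> (M i)" "lfp_henkin \<sigma> (N i)"
      "set (a i) \<subseteq> carr (M i)" "set (b i) \<subseteq> carr (N i)"
      using fam(1,2) i by (simp_all add: component_family_def)
    show ?thesis
    proof (cases "owner own t = i")
      case True
      have lt: "local_tm t \<in> terms W (length (a i))" "tm_fv (local_tm t) \<subseteq> ?V i"
        using local_tm_in_terms[OF t, of own] True comp(2) by simp_all
      have "val (a i) g (local_tm t) \<in> carr (M i)" "val (b i) h (local_tm t) \<notin> Ds i"
        using vM(3) D(2) Ds(1) vN(2) True i by auto
      from preserves_Lfp_term[OF pres W comp(1) Ds(2)[OF i] lt this] obtain Ci where "Ci \<in> adm (M i)" "val (a i) g (local_tm t) \<notin> Ci"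
        "\<forall>c\<in>carr (M i) - Ci. \<exists>d\<in>carr (N i) - Ds i.
          preserves n (insert x (?V i)) ?S ?T (M i) (A i) (a i) (g(x := c)) ((Gs i)(X := Ci))
            (N i) (B i) (b i) (h(x := d)) ((Hs i)(X := Ds i))"
        "preserves n (?V i - {x}) ?S ?T
           (M i) (A i) (a i) g ((Gs i)(X := Ci)) (N i) (B i) (b i) h ((Hs i)(X := Ds i))" .
      then show ?thesis using vM(2) True by (intro exI[of _ Ci]) auto
    next
      case False
      from preserves_Lfp[OF pres W comp(1) Ds(2)[OF i] comp(3-6)]
      obtain Ci where "Ci \<in> adm (M i)"
        "\<forall>c\<in>carr (M i) - Ci. \<exists>d\<in>carr (N i) - Ds i.
          preserves n (insert x (?V i)) ?S ?T (M i) (A i) (a i) (g(x := c)) ((Gs i)(X := Ci))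
            (N i) (B i) (b i) (h(x := d)) ((Hs i)(X := Ds i))"
        "preserves n (?V i - {x}) ?S ?T
           (M i) (A i) (a i) g ((Gs i)(X := Ci)) (N i) (B i) (b i) h ((Hs i)(X := Ds i))" .
      then show ?thesis using False by (intro exI[of _ Ci]) auto
    qed
  qed
  then have "\<exists>Cs. \<forall>i\<in>{1..k}. ?good i (Cs i)" by (intro bchoice) blast
  then obtain Cs where Cs: "\<And>i. i \<in> {1..k} \<Longrightarrow> ?good i (Cs i)" by blast
  define C where "C = (\<Union>i\<in>{1..k}. Cs i)"
  have adm: "\<And>i. i \<in> {1..k} \<Longrightarrow> Cs i \<in> adm (M i)" using Cs by blast
  have C_Int: "\<And>i. i \<in> {1..k} \<Longrightarrow> C \<inter> carr (M i) = Cs i"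
    unfolding C_def using union_Int_component[OF fam(1) adm] by blast
  have D_Int: "\<And>i. i \<in> {1..k} \<Longrightarrow> D \<inter> carr (N i) = Ds i"
    unfolding Ds(1) using union_Int_component[OF fam(2) Ds(2)] by blast
  show thesis
  proof (rule that)
    show "C \<in> adm (fusion \<sigma> f k M)"
      using adm by (auto simp: fusion_simps C_def)
    show "val (join k a) g t \<notin> C"
      using Cs[OF vM(1)] C_Int[OF vM(1)] vM(2,3) by auto
    show "\<forall>c\<in>carr (fusion \<sigma> f k M) - C. \<exists>d\<in>carr (fusion \<sigma> f k N) - D. \<exists>own' Gs' Hs'.
       linked n (insert x V) ?S ?T own' M A a (g(x := c)) (G(X := C)) Gs'
         N B b (h(x := d)) (H(X := D)) Hs'"
    proof
      fix c assume "c \<in> carr (fusion \<sigma> f k M) - C"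
      then have c: "c \<in> carr (fusion \<sigma> f k M)" "c \<notin> C" by blast+
      then obtain i where i: "i \<in> {1..k}" "c \<in> carr (M i)" by (auto simp: fusion_simps)
      then have "c \<in> carr (M i) - Cs i" using c(2) C_Int by blast
      with Cs[OF i(1)] obtain d where d: "d \<in> carr (N i)" "d \<notin> Ds i" and
        pres_d: "preserves n (insert x (?V i)) ?S ?T
          (M i) (A i) (a i) (g(x := c)) ((Gs i)(X := Cs i))
          (N i) (B i) (b i) (h(x := d)) ((Hs i)(X := Ds i))" by blast
      have "preserves n {y \<in> insert x V. (own(x := i)) y = j} ?S ?T
          (M j) (A j) (a j) (g(x := c)) ((Gs j)(X := Cs j))
          (N j) (B j) (b j) (h(x := d)) ((Hs j)(X := Ds j))"
        if "j \<in> {1..k}" for j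
      proof (cases "j = i")
        case True
        from pres_d show ?thesis unfolding True owned_upd(1) .
      next
        case False
        have "preserves n (?V j - {x}) ?S ?T
            (M j) (A j) (a j) g ((Gs j)(X := Cs j)) (N j) (B j) (b j) h ((Hs j)(X := Ds j))"
          using Cs[OF that] by blast
        then have "preserves n (?V j - {x}) ?S ?T
            (M j) (A j) (a j) (g(x := c)) ((Gs j)(X := Cs j))
            (N j) (B j) (b j) (h(x := d)) ((Hs j)(X := Ds j))"
          by (rule preserves_cong) auto
        then show ?thesis unfolding owned_upd(2)[OF False] .
      qed
      \<comment> \<open>Globally \<open>X\<close> denotes the union \<open>C\<close>, while
        component \<open>j\<close> reads it as its part \<open>Cs j\<close>; on
        \<open>carr (M j)\<close> the two agree.\<close>
      moreover have "(G(X := C)) Y \<inter> carr (M j) = ((Gs j)(X := Cs j)) Y \<inter> carr (M j) \<and>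
          (H(X := D)) Y \<inter> carr (N j) = ((Hs j)(X := Ds j)) Y \<inter> carr (N j)"
        if "j \<in> {1..k}" "Y \<in> ?S \<union> ?T" for j Y
      proof (cases "Y = X")
        case True
        have "C \<inter> carr (M j) = Cs j \<inter> carr (M j)" "D \<inter> carr (N j) = Ds j \<inter> carr (N j)"
          using C_Int[OF that(1)] D_Int[OF that(1)] by blast+
        with True show ?thesis by simp
      next
        case False
        then have "Y \<in> Sp \<union> Sn" using that(2) by blast
        with False linked that(1) show ?thesis by (simp add: linked_def)
      qed
      ultimately have "linked n (insert x V) ?S ?T (own(x := i))
          M A a (g(x := c)) (G(X := C)) (\<lambda>j. (Gs j)(X := Cs j))
          N B b (h(x := d)) (H(X := D)) (\<lambda>j. (Hs j)(X := Ds j))"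
        using fam(1,2) placed_upd[OF fam(3) i] placed_upd[OF fam(4) i(1) d(1)]
        unfolding linked_def by blast
      moreover have "d \<in> carr (fusion \<sigma> f k N) - D"
        using d i(1) D_Int[OF i(1)] by (auto simp: fusion_simps)
      ultimately show "\<exists>d\<in>carr (fusion \<sigma> f k N) - D. \<exists>own' Gs' Hs'.
         linked n (insert x V) ?S ?T own' M A a (g(x := c)) (G(X := C)) Gs'
           N B b (h(x := d)) (H(X := D)) Hs'" by blast
    qed
  qed
qed

text \<open>Negation exchanges the two directions together with the polarity lists, so they are
  proved at once. A quantifier or fixed point spends one step of \<open>n\<close> and changes owners
  and assignments, which are therefore generalised.\<close>

lemma linked_sat_fusion:
  assumes f: "fusion_map k \<sigma> f"
  shows "linked n V Sp Sn own M A a g G Gs N B b h H Hs \<Longrightarrow>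
    lfp_formula \<sigma> set_count cst_count \<phi> \<Longrightarrow> (\<Union>P\<in>set_fm \<phi>. {Q. Inl Q \<in> set_fm (f P)}) \<subseteq> \<Sigma> \<Longrightarrow>
    vars \<phi> \<subseteq> W \<Longrightarrow> qdepth \<phi> \<le> n \<Longrightarrow>
    (ctxt_ok V Sp Sn \<phi> \<longrightarrow> sat (fusion \<sigma> f k M) (all_unions (join k A)) (join k a) g G \<phi> \<longrightarrow>
       sat (fusion \<sigma> f k N) (all_unions (join k B)) (join k b) h H \<phi>) \<and>
    (ctxt_ok V Sn Sp \<phi> \<longrightarrow> sat (fusion \<sigma> f k N) (all_unions (join k B)) (join k b) h H \<phi> \<longrightarrow>
       sat (fusion \<sigma> f k M) (all_unions (join k A)) (join k a) g G \<phi>)"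
proof (induction \<phi> arbitrary: n V Sp Sn own g G Gs h H Hs)
  case (Rel P ts)
  have "set ts \<subseteq> terms (V \<inter> W) cst_count" if "(\<Union>t\<in>set ts. tm_fv t) \<subseteq> V"
    using Rel.prems(2,4) that by (auto simp: terms_def)
  then show ?case
    using linked_Rel_iff[OF Rel.prems(1) f, of P ts] Rel.prems(2,3) by auto
next
  case (Eq s t)
  have "s \<in> terms (V \<inter> W) cst_count \<and> t \<in> terms (V \<inter> W) cst_count"
    if "tm_fv s \<subseteq> V \<and> tm_fv t \<subseteq> V"
    using Eq.prems(2,4) that by (auto simp: terms_def)
  then show ?case using linked_eq_iff[OF Eq.prems(1), of s t] by auto
next
  case (SVar X t)
  have "X \<in> W" "t \<in> terms (V \<inter> W) cst_count" if "tm_fv t \<subseteq> V"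
    using SVar.prems(2,4) that by (auto simp: terms_def)
  then show ?case
    using linked_SVar[OF SVar.prems(1), of X t] linked_SVar[OF linked_swap[OF SVar.prems(1)], of X t]
    by auto
next
  case (SPar j t)
  have "t \<in> terms (V \<inter> W) cst_count" if "tm_fv t \<subseteq> V"
    using SPar.prems(2,4) that by (auto simp: terms_def)
  then show ?case using linked_SPar_iff[OF SPar.prems(1), of t j] SPar.prems(2) by auto
next
  case (Neg \<phi>)
  have "lfp_formula \<sigma> set_count cst_count \<phi>"
    "(\<Union>P\<in>set_fm \<phi>. {Q. Inl Q \<in> set_fm (f P)}) \<subseteq> \<Sigma>" "vars \<phi> \<subseteq> W" "qdepth \<phi> \<le> n"
    using Neg.prems(2-) by simp_all
  from Neg.IH[OF Neg.prems(1) this] show ?case by auto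
next
  case (Conj \<phi> \<psi>)
  have \<phi>: "lfp_formula \<sigma> set_count cst_count \<phi>"
    "(\<Union>P\<in>set_fm \<phi>. {Q. Inl Q \<in> set_fm (f P)}) \<subseteq> \<Sigma>" "vars \<phi> \<subseteq> W" "qdepth \<phi> \<le> n"
    and \<psi>: "lfp_formula \<sigma> set_count cst_count \<psi>"
    "(\<Union>P\<in>set_fm \<psi>. {Q. Inl Q \<in> set_fm (f P)}) \<subseteq> \<Sigma>" "vars \<psi> \<subseteq> W" "qdepth \<psi> \<le> n"
    using Conj.prems(2-) by simp_all
  from Conj.IH(1)[OF Conj.prems(1) \<phi>] Conj.IH(2)[OF Conj.prems(1) \<psi>] show ?case by auto
next
  case (Ex x \<phi>)
  then obtain m where n: "n = Suc m" by (cases n) auto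
  have \<phi>: "lfp_formula \<sigma> set_count cst_count \<phi>"
    "(\<Union>P\<in>set_fm \<phi>. {Q. Inl Q \<in> set_fm (f P)}) \<subseteq> \<Sigma>" "vars \<phi> \<subseteq> W" "qdepth \<phi> \<le> m"
    and x: "x \<in> W"
    using Ex.prems(2-) n by simp_all
  note linked = Ex.prems(1)[unfolded n]
  show ?case
  proof (intro conjI impI)
    assume ok: "ctxt_ok V Sp Sn (Ex x \<phi>)"
      and "sat (fusion \<sigma> f k M) (all_unions (join k A)) (join k a) g G (Ex x \<phi>)"
    then obtain c where c: "c \<in> carr (fusion \<sigma> f k M)"
      "sat (fusion \<sigma> f k M) (all_unions (join k A)) (join k a) (g(x := c)) G \<phi>" by auto
    from linked_Ex[OF linked x c(1)] obtain d own' where d: "d \<in> carr (fusion \<sigma> f k N)"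
      and l: "linked m (insert x V) Sp Sn own' M A a (g(x := c)) G Gs N B b (h(x := d)) H Hs" .
    have "sat (fusion \<sigma> f k N) (all_unions (join k B)) (join k b) (h(x := d)) H \<phi>"
      using Ex.IH[OF l \<phi>] ok c(2) unfolding ctxt_ok_simps by blast
    with d show "sat (fusion \<sigma> f k N) (all_unions (join k B)) (join k b) h H (Ex x \<phi>)"
      unfolding sat.simps by blast
  next
    assume ok: "ctxt_ok V Sn Sp (Ex x \<phi>)"
      and "sat (fusion \<sigma> f k N) (all_unions (join k B)) (join k b) h H (Ex x \<phi>)"
    then obtain d where d: "d \<in> carr (fusion \<sigma> f k N)"
      "sat (fusion \<sigma> f k N) (all_unions (join k B)) (join k b) (h(x := d)) H \<phi>" by auto
    from linked_Ex[OF linked_swap[OF linked] x d(1)] obtain c own' where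
      c: "c \<in> carr (fusion \<sigma> f k M)"
      and l: "linked m (insert x V) Sn Sp own' N B b (h(x := d)) H Hs M A a (g(x := c)) G Gs" .
    have "sat (fusion \<sigma> f k M) (all_unions (join k A)) (join k a) (g(x := c)) G \<phi>"
      using Ex.IH[OF linked_swap[OF l] \<phi>] ok d(2) unfolding ctxt_ok_simps by blast
    with c show "sat (fusion \<sigma> f k M) (all_unions (join k A)) (join k a) g G (Ex x \<phi>)"
      unfolding sat.simps by blast
  qed
next
  case (Lfp X x \<phi> t)
  then obtain m where n: "n = Suc m" by (cases n) auto
  have \<phi>: "lfp_formula \<sigma> set_count cst_count \<phi>"
    "(\<Union>P\<in>set_fm \<phi>. {Q. Inl Q \<in> set_fm (f P)}) \<subseteq> \<Sigma>" "vars \<phi> \<subseteq> W" "qdepth \<phi> \<le> m"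
    and xX: "x \<in> W" "X \<in> W" and pos: "positive_in X \<phi>"
    using Lfp.prems(2-) n by simp_all
  have t: "t \<in> terms (V \<inter> W) cst_count" if "tm_fv t \<subseteq> V"
    using Lfp.prems(2,4) that by (auto simp: terms_def)
  note linked = Lfp.prems(1)[unfolded n]
  let ?FM = "fusion \<sigma> f k M" and ?FN = "fusion \<sigma> f k N"
  let ?sM = "sat ?FM (all_unions (join k A)) (join k a)"
  let ?sN = "sat ?FN (all_unions (join k B)) (join k b)"
  show ?case
  proof (intro conjI impI)
    assume "ctxt_ok V Sp Sn (Lfp X x \<phi> t)" and sat: "?sM g G (Lfp X x \<phi> t)"
    with pos have ok: "ctxt_ok (insert x V) (insert X Sp) (Sn - {X}) \<phi>" "tm_fv t \<subseteq> V"
      using ctxt_ok_Lfp by blast+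
    \<comment> \<open>A closed \<open>D\<close> omitting the term is matched by some
      \<open>C\<close> omitting it. The fixed point holds in the fusion of the \<open>M i\<close>,
      so \<open>C\<close> is not closed; the answer to a point witnessing this shows that
      \<open>D\<close> is not closed either.\<close>
    have "val (join k b) h t \<in> D"
      if D: "D \<in> adm ?FN" "\<forall>d\<in>carr ?FN. ?sN (h(x := d)) (H(X := D)) \<phi> \<longrightarrow> d \<in> D" for D
    proof (rule ccontr)
      assume "val (join k b) h t \<notin> D"
      from linked_Lfp[OF linked xX t[OF ok(2)] D(1) this] obtain C where
        C: "C \<in> adm ?FM" "val (join k a) g t \<notin> C"
        "\<forall>c\<in>carr ?FM - C. \<exists>d\<in>carr ?FN - D. \<exists>own' Gs' Hs'.
         linked m (insert x V) (insert X Sp) (Sn - {X}) own' M A a (g(x := c)) (G(X := C)) Gs'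
           N B b (h(x := d)) (H(X := D)) Hs'" .
      from sat C(1,2) obtain c where c: "c \<in> carr ?FM" "c \<notin> C" "?sM (g(x := c)) (G(X := C)) \<phi>"
        unfolding sat.simps by blast
      with C(3) obtain d own' Gs' Hs' where d: "d \<in> carr ?FN" "d \<notin> D"
        and l: "linked m (insert x V) (insert X Sp) (Sn - {X}) own' M A a (g(x := c)) (G(X := C)) Gs'
           N B b (h(x := d)) (H(X := D)) Hs'" by blast
      have "?sN (h(x := d)) (H(X := D)) \<phi>"
        using Lfp.IH[OF l \<phi>] ok(1) c(3) by blast
      with D(2) d show False by blast
    qed
    then show "?sN h H (Lfp X x \<phi> t)" unfolding sat.simps by blast
  next
    assume "ctxt_ok V Sn Sp (Lfp X x \<phi> t)" and sat: "?sN h H (Lfp X x \<phi> t)"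
    with pos have ok: "ctxt_ok (insert x V) (insert X Sn) (Sp - {X}) \<phi>" "tm_fv t \<subseteq> V"
      using ctxt_ok_Lfp by blast+
    \<comment> \<open>The same argument with the two sides exchanged by
      \<open>linked_swap\<close>.\<close>
    have "val (join k a) g t \<in> C"
      if C: "C \<in> adm ?FM" "\<forall>c\<in>carr ?FM. ?sM (g(x := c)) (G(X := C)) \<phi> \<longrightarrow> c \<in> C" for C
    proof (rule ccontr)
      assume "val (join k a) g t \<notin> C"
      from linked_Lfp[OF linked_swap[OF linked] xX t[OF ok(2)] C(1) this] obtain D where
        D: "D \<in> adm ?FN" "val (join k b) h t \<notin> D"
        "\<forall>d\<in>carr ?FN - D. \<exists>c\<in>carr ?FM - C. \<exists>own' Hs' Gs'.
         linked m (insert x V) (insert X Sn) (Sp - {X}) own' N B b (h(x := d)) (H(X := D)) Hs'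
           M A a (g(x := c)) (G(X := C)) Gs'" .
      from sat D(1,2) obtain d where d: "d \<in> carr ?FN" "d \<notin> D" "?sN (h(x := d)) (H(X := D)) \<phi>"
        unfolding sat.simps by blast
      with D(3) obtain c own' Hs' Gs' where c: "c \<in> carr ?FM" "c \<notin> C"
        and l: "linked m (insert x V) (insert X Sn) (Sp - {X}) own' N B b (h(x := d)) (H(X := D)) Hs'
           M A a (g(x := c)) (G(X := C)) Gs'" by blast
      have "?sM (g(x := c)) (G(X := C)) \<phi>"
        using Lfp.IH[OF linked_swap[OF l] \<phi>] ok(1) d(3) by blast
      with C(2) c show False by blast
    qed
    then show "?sM g G (Lfp X x \<phi> t)" unfolding sat.simps by blast
  qed
qed

end

section \<open>Sentences and the theorem on fusions\<close>

lemma models_iff_sat: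
  assumes "fv \<phi> = {}" "fsv \<phi> = {}"
  shows "models (M, As, cs) \<phi> \<longleftrightarrow> sat M As cs g G \<phi>"
proof -
  have "sat M As cs g' G' \<phi> = sat M As cs g G \<phi>" for g' G'
    by (rule sat_cong) (simp_all add: assms)
  then show ?thesis unfolding models_def prod.case by blast
qed

text \<open>With \<open>V\<close>, \<open>Sp\<close> and \<open>Sn\<close> empty, exactly the
  sentences are allowed, and their truth ignores the assignments. This is the initial position of
  the game.\<close>

lemma (in finite_language) preserves_if_lfp_equiv:
  assumes "lfp_equiv \<sigma> n (M, As, cs) (N, Bs, ds)"
  shows "preserves n {} {} {} M As cs g G N Bs ds h H"
  unfolding preserves_def
proof (intro conjI ballI impI)
  show "length As = length Bs" "length cs = length ds"
    using assms by (simp_all add: lfp_equiv_def)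
  fix \<phi>
  assume \<phi>: "\<phi> \<in> fragment \<sigma> \<Sigma> W (length As) (length cs) n" "ctxt_ok {} {} {} \<phi>"
    and sat: "sat M As cs g G \<phi>"
  from \<phi>(2) have closed: "fv \<phi> = {}" "fsv \<phi> = {}" by (simp_all add: ctxt_ok_sentence)
  with \<phi>(1) have "lfp_sentence \<sigma> (length As) (length cs) \<phi>" "qdepth \<phi> \<le> n"
    by (simp_all add: lfp_sentence_def fragment_def)
  with assms have "models (M, As, cs) \<phi> \<longleftrightarrow> models (N, Bs, ds) \<phi>"
    by (simp add: lfp_equiv_def)
  with sat show "sat N Bs ds h H \<phi>"
    using models_iff_sat[OF closed, of M As cs g G] models_iff_sat[OF closed, of N Bs ds h H]
    by simp
qed

theorem theorem5p32:
  fixes \<sigma> :: "'p voc" and k n :: nat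
    and f :: "'p \<Rightarrow> ('p + nat) fm"
    and M :: "nat \<Rightarrow> ('a, 'p) frame" and N :: "nat \<Rightarrow> ('b, 'p) frame"
    and A :: "nat \<Rightarrow> 'a set list" and B :: "nat \<Rightarrow> 'b set list"
    and a :: "nat \<Rightarrow> 'a list" and b :: "nat \<Rightarrow> 'b list"
  assumes "fusion_map k \<sigma> f"
    and "\<And>i. i \<in> {1..k} \<Longrightarrow> lfp_henkin \<sigma> (M i)"
    and "\<And>i. i \<in> {1..k} \<Longrightarrow> lfp_henkin \<sigma> (N i)"
    and "disjoint_family_on (\<lambda>i. carr (M i)) {1..k}"
    and "disjoint_family_on (\<lambda>i. carr (N i)) {1..k}"
    and "\<And>i. i \<in> {1..k} \<Longrightarrow> a i \<noteq> [] \<and> set (a i) \<subseteq> carr (M i)"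
    and "\<And>i. i \<in> {1..k} \<Longrightarrow> b i \<noteq> [] \<and> set (b i) \<subseteq> carr (N i)"
    and "\<And>i. i \<in> {1..k} \<Longrightarrow> length (a i) = length (b i)"
    and "\<And>i. i \<in> {1..k} \<Longrightarrow> set (A i) \<subseteq> adm (M i)"
    and "\<And>i. i \<in> {1..k} \<Longrightarrow> set (B i) \<subseteq> adm (N i)"
    and "\<And>i. i \<in> {1..k} \<Longrightarrow> length (A i) = length (B i)"
    and "\<And>i. i \<in> {1..k} \<Longrightarrow> lfp_equiv \<sigma> n (M i, A i, a i) (N i, B i, b i)"
  shows "lfp_equiv \<sigma> n
           (fusion \<sigma> f k M, all_unions (join k A), join k a)
           (fusion \<sigma> f k N, all_unions (join k B), join k b)"
proof -
  define la lA where "la i = length (a i)" and "lA i = length (A i)" for i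
  have len_a: "join k a = map (\<lambda>(i, j). a i ! j) (positions k la)"
    by (rule join_positions) (simp add: la_def)
  have len_b: "join k b = map (\<lambda>(i, j). b i ! j) (positions k la)"
    by (rule join_positions) (use assms(8) in \<open>simp add: la_def\<close>)
  have len_A: "all_unions (join k A) = map (\<lambda>I. \<Union>(i, j)\<in>set I. A i ! j) (subseqs (positions k lA))"
    by (rule all_unions_join) (simp add: lA_def)
  have len_B: "all_unions (join k B) = map (\<lambda>I. \<Union>(i, j)\<in>set I. B i ! j) (subseqs (positions k lA))"
    by (rule all_unions_join) (use assms(11) in \<open>simp add: lA_def\<close>)
  have "models (fusion \<sigma> f k M, all_unions (join k A), join k a) \<phi> \<longleftrightarrow>
      models (fusion \<sigma> f k N, all_unions (join k B), join k b) \<phi>"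
    if \<phi>: "lfp_sentence \<sigma> (length (all_unions (join k A))) (length (join k a)) \<phi>" "qdepth \<phi> \<le> n"
    for \<phi>
  proof -
    \<comment> \<open>The components never see the symbols of \<open>\<phi>\<close> itself, only
      those in the fusion formulas of these symbols.\<close>
    define \<Sigma> where "\<Sigma> = (\<Union>P\<in>set_fm \<phi>. {Q. Inl Q \<in> set_fm (f P)})"
    have "finite {Q. Inl Q \<in> set_fm (f P)}" for P
      using finite_vimageI[OF finite_set_fm inj_Inl] by (simp add: vimage_def)
    then interpret fusion_comparison \<sigma> \<Sigma> "vars \<phi>" f k la lA
      by unfold_locales (simp_all add: \<Sigma>_def finite_set_fm finite_vars)
    have closed: "fv \<phi> = {}" "fsv \<phi> = {}" using \<phi>(1) by (simp_all add: lfp_sentence_def)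
    have "component_family M A a"
      unfolding component_family_def using assms by (simp add: la_def lA_def)
    moreover have "component_family N B b"
      unfolding component_family_def using assms by (simp add: la_def lA_def)
    \<comment> \<open>No variable is in play yet, so arbitrary assignments will do, as will the
      owner \<open>0\<close>, which is no component.\<close>
    ultimately have linked: "linked n {} {} {} (\<lambda>_. 0) M A a (\<lambda>_. undefined) (\<lambda>_. {}) (\<lambda>_ _. {})
        N B b (\<lambda>_. undefined) (\<lambda>_. {}) (\<lambda>_ _. {})"
      using preserves_if_lfp_equiv[OF assms(12)] by (simp add: linked_def placed_def)
    have "lfp_formula \<sigma> set_count cst_count \<phi>"
      using \<phi>(1) by (simp add: lfp_sentence_def len_A len_a)
    from linked_sat_fusion[OF assms(1) linked this _ order_refl \<phi>(2)] closed
    show ?thesis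
      unfolding models_iff_sat[OF closed, of _ _ _ "\<lambda>_. undefined" "\<lambda>_. {}"]
      by (auto simp: \<Sigma>_def ctxt_ok_sentence)
  qed
  then show ?thesis
    by (simp add: lfp_equiv_def len_A len_B len_a len_b)
qed

end
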